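(* There exists a constant $\gamma>0.04$ such that the following holds: for every non-constant function $f:\{0,1\}^{m}\to\{0,1\}$ and for every $n\in\mathbb{N}$ there exists a function $g:\{0,1\}^{n}\to\{0,1\}$ such that \[ \mathsf{CC}(\mathit{KW}_{f}\circledast\mathit{KW}_{g})\ge\log\mathsf{L}(\mathit{KW}_{f})-(1-\gamma)\cdot m+n-O\left(\log(m\cdot n)\right), \] where the $O(\cdot)$ hides a universal constant.
   Context: All logarithms are base 2. For $g:\{0,1\}^n\to\{0,1\}$ and a matrix $X\in\{0,1\}^{m\times n}$ with rows $X_1,\dots,X_m$, $g(X)\in\{0,1\}^m$ is the column vector $(g(X_1),\dots,g(X_m))$, and the composition $f\diamond g:\{0,1\}^{m\times n}\to\{0,1\}$ is $(f\diamond g)(X)=f(g(X))$. For a non-constant $f$, the Karchmer–Wigderson relation $\mathit{KW}_f$ is the communication problem in which Alice gets $x\in f^{-1}(1)$, Bob gets $y\in f^{-1}(0)$, and they must output a coordinate $i$ with $x_i\neq y_i$. The strong composition $\mathit{KW}_f\circledast\mathit{KW}_g$ is the communication problem in which Alice gets $X\in(f\diamond g)^{-1}(1)$, Bob gets $Y\in(f\diamond g)^{-1}(0)$, and, writing $a=g(X)$, $b=g(Y)$, they must output an entry $(i,j)\in[m]\times[n]$ such that both $a_i\neq b_i$ and $X_{i,j}\neq Y_{i,j}$. $\mathsf{CC}(R)$ denotes the deterministic communication complexity of a relation $R$ (the minimal depth of a deterministic protocol tree solving $R$), and $\mathsf{L}(R)$ denotes the protocol size of $R$, i.e., the minimal number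 of leaves of a deterministic protocol solving $R$ (for $R=\mathit{KW}_f$ this equals the minimal number of leaves of a de Morgan formula computing $f$). *)

theory Defs
  imports Complex_Main
begin

text \<open>
  Bit strings in \<open>{0,1}\<^sup>n\<close> are boolean lists of length \<open>n\<close>, and matrices in \<open>{0,1}\<^bsup>m \<times> n\<^esup>\<close> are lists of
  \<open>m\<close> rows.  A function \<open>{0,1}\<^sup>n \<rightarrow> {0,1}\<close> is a function on all boolean lists of which only the
  values on \<open>cube n\<close> matter.  Coordinates are numbered from 0.
\<close>

definition cube :: "nat \<Rightarrow> bool list set" where
  "cube n = {x. length x = n}"

definition bool_matrices :: "nat \<Rightarrow> nat \<Rightarrow> bool list list set" where
  "bool_matrices m n = {X. length X = m \<and> set X \<subseteq> cube n}"

definition nonconstant :: "nat \<Rightarrow> (bool list \<Rightarrow> bool) \<Rightarrow> bool" where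
  "nonconstant n f \<longleftrightarrow> (\<exists>x\<in>cube n. \<exists>y\<in>cube n. f x \<noteq> f y)"

definition rowwise :: "(bool list \<Rightarrow> bool) \<Rightarrow> bool list list \<Rightarrow> bool list" where
  "rowwise g X = map g X"

definition block_comp ::
    "(bool list \<Rightarrow> bool) \<Rightarrow> (bool list \<Rightarrow> bool) \<Rightarrow> bool list list \<Rightarrow> bool" (infixr "\<diamondop>" 70) where
  "(f \<diamondop> g) X = f (rowwise g X)"


record ('x, 'y, 'o) comm_problem =
  alice_inputs :: "'x set"
  bob_inputs :: "'y set"
  correct :: "'x \<Rightarrow> 'y \<Rightarrow> 'o \<Rightarrow> bool"

text \<open>
  At an internal node, the owner sends one bit computed from his or her own input; the first
  subtree is taken when the bit is 1.
\<close>

datatype ('x, 'y, 'o) protocol =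
    Output 'o
  | Alice "'x \<Rightarrow> bool" "('x, 'y, 'o) protocol" "('x, 'y, 'o) protocol"
  | Bob "'y \<Rightarrow> bool" "('x, 'y, 'o) protocol" "('x, 'y, 'o) protocol"

primrec run :: "('x, 'y, 'o) protocol \<Rightarrow> 'x \<Rightarrow> 'y \<Rightarrow> 'o" where
  "run (Output z) x y = z"
| "run (Alice b P Q) x y = (if b x then run P x y else run Q x y)"
| "run (Bob b P Q) x y = (if b y then run P x y else run Q x y)"

primrec depth :: "('x, 'y, 'o) protocol \<Rightarrow> nat" where
  "depth (Output z) = 0"
| "depth (Alice b P Q) = Suc (max (depth P) (depth Q))"
| "depth (Bob b P Q) = Suc (max (depth P) (depth Q))"

primrec leaves :: "('x, 'y, 'o) protocol \<Rightarrow> nat" where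
  "leaves (Output z) = 1"
| "leaves (Alice b P Q) = leaves P + leaves Q"
| "leaves (Bob b P Q) = leaves P + leaves Q"

definition solves :: "('x, 'y, 'o) protocol \<Rightarrow> ('x, 'y, 'o) comm_problem \<Rightarrow> bool" where
  "solves P R \<longleftrightarrow> (\<forall>x\<in>alice_inputs R. \<forall>y\<in>bob_inputs R. correct R x y (run P x y))"

text \<open>
  The two minima below are meaningful only for problems that some protocol solves.  This holds for
  all problems defined in this theory when the functions involved are non-constant: the input sets
  are finite and every pair of inputs has a correct output.
\<close>

definition CC :: "('x, 'y, 'o) comm_problem \<Rightarrow> nat" where
  "CC R = (LEAST d. \<exists>P. solves P R \<and> depth P = d)"

definition protocol_size :: "('x, 'y, 'o) comm_problem \<Rightarrow> nat" where
  "protocol_size R = (LEAST l. \<exists>P. solves P R \<and> leaves P = l)"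


definition KW :: "nat \<Rightarrow> (bool list \<Rightarrow> bool) \<Rightarrow> (bool list, bool list, nat) comm_problem" where
  "KW m f =
    \<lparr> alice_inputs = {x \<in> cube m. f x},
      bob_inputs = {y \<in> cube m. \<not> f y},
      correct = (\<lambda>x y i. i < m \<and> x ! i \<noteq> y ! i) \<rparr>"

definition strong_comp_KW ::
    "nat \<Rightarrow> nat \<Rightarrow> (bool list \<Rightarrow> bool) \<Rightarrow> (bool list \<Rightarrow> bool) \<Rightarrow>
      (bool list list, bool list list, nat \<times> nat) comm_problem" where
  "strong_comp_KW m n f g =
    \<lparr> alice_inputs = {X \<in> bool_matrices m n. (f \<diamondop> g) X},
      bob_inputs = {Y \<in> bool_matrices m n. \<not> (f \<diamondop> g) Y},
      correct = (\<lambda>X Y (i, j). i < m \<and> j < n \<and>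
        rowwise g X ! i \<noteq> rowwise g Y ! i \<and> X ! i ! j \<noteq> Y ! i ! j) \<rparr>"

text \<open>
  In asymptotic bounds, \<open>O(log (m n))\<close> is read as a universal constant times
  \<open>max 1 (log 2 (m n))\<close>, where \<open>m, n \<ge> 1\<close>.  The maximum differs from \<open>log 2 (m n)\<close> only for
  \<open>m = n = 1\<close>, where the logarithm vanishes and a literal multiple of it would leave no error
  term at all.
\<close>

end

theory Submission
  imports Defs
begin

text \<open>
  Suppose that for every balanced \<open>g\<close> some protocol is too cheap.  Walk down the first \<open>t\<close> levels,
  \<open>t \<approx> log L(KW\<^sub>f) - (1 - \<gamma>) m\<close>, always with the majority bit over the matrices with a given column
  vector: this leaves a rectangle of column vectors \<open>a\<close>, \<open>b\<close> that is still hard for \<open>KW\<^sub>f\<close>, and for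
  each of them a set of matrices of density about \<open>2\<^bsup>-t\<^esup>\<close>.  Such a set is thick in a random set of
  rows: its prefix tree keeps more than half of the children at these rows.  Alice and Bob announce
  rows that suit both of them.  Since the rectangle is still hard, it contains \<open>a\<close>, \<open>b\<close> that
  agree outside the announced rows.

  The remaining protocol of depth \<open>n - O(log (m n))\<close> is a formula, and there are so few of
  these that two nearly complementary functions \<open>g\<close>, \<open>h\<close> share the formula, the rows, \<open>a\<close> and \<open>b\<close>.
  Descending both prefix trees at once gives \<open>X\<close> with \<open>g(X) = a\<close> and \<open>Y\<close> with \<open>h(Y) = b\<close> whose rows
  are equal wherever \<open>a\<close> and \<open>b\<close> differ, but the common formula must separate \<open>X\<close> from \<open>Y\<close> in such a
  row.
\<close>

section \<open>Random flags and thick sets\<close>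

text \<open>Budget behind \<open>1 / 24\<close>: each of the \<open>t\<close> walked bits may halve
  the size of the rectangle. The surviving sets have densities at least \<open>2 ^ -tA\<close> and
  \<open>2 ^ -tB\<close> with \<open>tA + tB <= t\<close>, and naming rows that suit such sets costs
  another factor \<open>2 ^ t\<close>, up to \<open>O(m ^ 2)\<close>. Alice keeps a third of the
  rows and Bob a quarter of hers, so at most \<open>11 / 12 * m\<close> rows stay unannounced, and a
  rectangle of size above \<open>3 * 2 powr (11 / 12 * m)\<close> contains \<open>a\<close>,
  \<open>b\<close> that agree there. Hence \<open>2 * t + 11 / 12 * m\<close> must stay below
  \<open>log L(KW_f)\<close>, up to logarithms; as that logarithm is at most \<open>m + 2\<close>,
  \<open>t = log L(KW_f) - 23 / 24 * m - O(log)\<close> qualifies. Thickness must exceed one half,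
  since two sets of children have to meet inside a union barely larger than one row set. This pushes
  the probability of keeping a row just below one half: \<open>49 / 100\<close>,
  \<open>51 / 100\<close> and the tolerance \<open>1 / 100\<close> for near complements belong
  together. Formulas are counted instead of protocols because predicates at protocol nodes are
  arbitrary functions of whole matrices, of which there are far too many.\<close>

abbreviation subflags :: "bool list \<Rightarrow> bool list \<Rightarrow> bool" where
  "subflags ks us \<equiv> list_all2 (\<longrightarrow>) ks us"

abbreviation trues :: "bool list \<Rightarrow> nat" where
  "trues ks \<equiv> count_list ks True"

text \<open>Expectation of \<open>F\<close> when every true flag of the given vector is kept independently with
  probability \<open>p\<close>.\<close>
primrec avg :: "real \<Rightarrow> bool list \<Rightarrow> (bool list \<Rightarrow> real) \<Rightarrow> real" where
  "avg p [] F = F []"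
| "avg p (u # us) F =
    (if u then p * avg p us (\<lambda>ks. F (True # ks)) + (1 - p) * avg p us (\<lambda>ks. F (False # ks))
     else avg p us (\<lambda>ks. F (False # ks)))"

lemma avg_mono:
  assumes "0 \<le> p" "p \<le> 1" "\<And>ks. subflags ks us \<Longrightarrow> F ks \<le> G ks"
  shows "avg p us F \<le> avg p us G"
  using assms(3)
proof (induction us arbitrary: F G)
  case (Cons u us)
  have "avg p us (\<lambda>ks. F (False # ks)) \<le> avg p us (\<lambda>ks. G (False # ks))"
    by (rule Cons.IH) (simp add: Cons.prems)
  moreover have "avg p us (\<lambda>ks. F (True # ks)) \<le> avg p us (\<lambda>ks. G (True # ks))" if u
    by (rule Cons.IH) (simp add: Cons.prems that)
  ultimately show ?case
    using assms(1,2) by (auto intro!: add_mono mult_left_mono)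
qed simp

lemma avg_const [simp]: "avg p us (\<lambda>_. c) = c"
  by (induction us) (auto simp: algebra_simps)

lemma avg_add: "avg p us (\<lambda>ks. F ks + G ks) = avg p us F + avg p us G"
  by (induction us arbitrary: F G) (auto simp: algebra_simps)

lemma avg_cmult: "avg p us (\<lambda>ks. c * F ks) = c * avg p us F"
  by (induction us arbitrary: F) (auto simp: algebra_simps)

lemma avg_sum: "avg p us (\<lambda>ks. \<Sum>x\<in>A. F x ks) = (\<Sum>x\<in>A. avg p us (F x))"
  by (induction A rule: infinite_finite_induct) (auto simp: avg_add)

text \<open>The flags are independent, so the generating function of a binomial variable factorises;
  it feeds the Chernoff bound \<open>few_trues_tail\<close>.\<close>

lemma avg_power_trues: "avg p us (\<lambda>ks. r ^ trues ks) = (1 - p + p * r) ^ trues us"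
proof (induction us)
  case (Cons u us)
  have "avg p us (\<lambda>ks. r * r ^ trues ks) = r * (1 - p + p * r) ^ trues us"
    by (simp add: avg_cmult Cons.IH)
  then show ?case
    using Cons.IH by (auto simp: algebra_simps)
qed simp

lemma avg_attained:
  assumes "0 \<le> p" "p \<le> 1"
  shows "\<exists>ks. subflags ks us \<and> avg p us F \<le> F ks"
proof (rule ccontr)
  assume neg: "\<not> ?thesis"
  \<comment> \<open>\<open>avg_mono\<close> is not strict, so finiteness of the set of subflags is
    used to get a uniform gap \<open>e\<close>. Inserting 1 makes the set under \<open>Min\<close>
    visibly nonempty.\<close>
  have "\<exists>e>0. \<forall>ks. subflags ks us \<longrightarrow> F ks + e \<le> avg p us F"
  proof -
    have fin: "finite {ks. subflags ks us}"
      by (rule finite_subset[OF _ finite_lists_length_eq[of UNIV "length us"]])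
        (auto dest: list_all2_lengthD)
    let ?D = "insert 1 ((\<lambda>ks. avg p us F - F ks) ` {ks. subflags ks us})"
    have finD: "finite ?D" using fin by simp
    have "\<forall>d\<in>?D. Min ?D \<le> d" using Min_le[OF finD] by blast
    moreover have "Min ?D \<in> ?D" using Min_in[OF finD] by blast
    moreover have "\<forall>d\<in>?D. d > 0"
      using neg by (auto simp: not_le)
    ultimately show ?thesis
      by (intro exI[of _ "Min ?D"]) (force simp del: Min_insert simp: algebra_simps)
  qed
  then obtain e where "e > 0" "\<And>ks. subflags ks us \<Longrightarrow> F ks + e \<le> avg p us F"
    by blast
  then have "avg p us (\<lambda>ks. F ks + e) \<le> avg p us (\<lambda>_. avg p us F)"
    using assms by (intro avg_mono) auto
  with \<open>e > 0\<close> show False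
    by (simp add: avg_add)
qed

text \<open>Read as a prefix tree, \<open>S\<close> contains a tree that branches at least \<open>s\<close>-fold at every flagged
  level.\<close>
primrec thick :: "nat \<Rightarrow> bool list \<Rightarrow> 'a list set \<Rightarrow> bool" where
  "thick s [] S \<longleftrightarrow> [] \<in> S"
| "thick s (k # ks) S \<longleftrightarrow>
    (if k then s \<le> card {x. thick s ks {xs. x # xs \<in> S}} else \<exists>x. thick s ks {xs. x # xs \<in> S})"

lemma thick_nonempty: "thick s ks S \<Longrightarrow> s > 0 \<Longrightarrow> S \<noteq> {}"
proof (induction ks arbitrary: S)
  case (Cons k ks)
  obtain x where "thick s ks {xs. x # xs \<in> S}"
  proof (cases k)
    case True
    then have "{x. thick s ks {xs. x # xs \<in> S}} \<noteq> {}"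
      using Cons.prems by (metis card.empty leD thick.simps(2))
    then show ?thesis using that by blast
  qed (use Cons.prems that in auto)
  then show ?case using Cons by blast
qed auto

lemma thick_successors:
  assumes "s > 0" "S \<subseteq> {xs. list_all2 (\<in>) xs (A # As)}"
  shows "{x. thick s ks {xs. x # xs \<in> S}} \<subseteq> A"
  using thick_nonempty[OF _ assms(1)] assms(2) by fastforce

text \<open>At least \<open>s > 0\<close> children include one child, so a flag may be dropped at
  any level. This lets Bob thin out the rows announced by Alice without spoiling her
  thickness.\<close>

lemma thick_subflags:
  assumes "thick s ks S" "subflags ls ks" "s > 0" "S \<subseteq> {xs. list_all2 (\<in>) xs As}"
    "\<forall>A\<in>set As. finite A" "length As = length ks"
  shows "thick s ls S"
  using assms(2,1,4-6)
proof (induction ls ks arbitrary: S As rule: list_all2_induct)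
  case (Cons l ls k ks)
  obtain A As' where As: "As = A # As'"
    using Cons.prems by (cases As) auto
  let ?D = "\<lambda>x. {xs. x # xs \<in> S}"
  have IH: "thick s ls (?D x)" if "thick s ks (?D x)" for x
    by (rule Cons.IH[of "?D x" As']) (use that Cons.prems As in auto)
  have fin: "finite {x. thick s ls (?D x)}"
    using thick_successors[OF \<open>s > 0\<close>, of S A As'] Cons.prems As by (auto intro: finite_subset)
  show ?case
  proof (cases k)
    case True
    have le: "s \<le> card {x. thick s ls (?D x)}"
      using Cons.prems(1) True by (auto intro!: order.trans[OF _ card_mono[OF fin]] IH)
    moreover have "\<exists>x. thick s ls (?D x)"
    proof -
      have "{x. thick s ls (?D x)} \<noteq> {}"
        using le \<open>s > 0\<close> by (metis card.empty leD)
      then show ?thesis by blast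
    qed
    ultimately show ?thesis by simp
  next
    case False
    then have "\<not> l" using Cons.hyps by simp
    from False obtain x where "thick s ks (?D x)" using Cons.prems(1) by auto
    then have "thick s ls (?D x)" by (rule IH)
    with \<open>\<not> l\<close> show ?thesis by auto
  qed
qed simp

lemma card_lists_split:
  assumes "finite S" "finite A" "S \<subseteq> {xs. list_all2 (\<in>) xs (A # As)}"
  shows "card S = (\<Sum>x\<in>A. card {xs. x # xs \<in> S})"
proof -
  let ?D = "\<lambda>x. {xs. x # xs \<in> S}"
  have fin: "finite (?D x)" for x
    by (rule finite_imageD[of "(#) x"]) (auto intro: finite_subset[OF _ assms(1)] simp: inj_on_def)
  have "S = (\<lambda>(x, xs). x # xs) ` (SIGMA x:A. ?D x)"
    using assms(3) by (force simp: image_iff list_all2_Cons2)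
  then have "card S = card (SIGMA x:A. ?D x)"
    by (metis (no_types, lifting) card_image inj_onI list.inject prod.collapse case_prod_beta)
  with fin assms(2) show ?thesis by simp
qed

text \<open>A weighted form of Pajor's strengthening of the Sauer-Shelah lemma: the density of \<open>S\<close> bounds
  the probability that random flags are thick from below.  The weights solve
  \<open>(1 - p) q = s - 1\<close>, the largest number of branches that is not yet \<open>s\<close>-fold.\<close>
lemma thick_card:
  assumes p: "0 \<le> p" "p \<le> 1" "real s - 1 \<le> (1 - p) * real q" "s > 0"
  assumes "S \<subseteq> {xs. list_all2 (\<in>) xs As}" "\<forall>A\<in>set As. finite A \<and> card A = q"
    "length As = length us" "finite S"
  shows "real (card S) \<le> real q ^ length us * avg p us (\<lambda>ks. of_bool (thick s ks S))"
  using assms(5-)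
proof (induction us arbitrary: S As)
  case Nil
  then have "S \<subseteq> {[]}" by auto
  then show ?case by (auto simp: subset_singleton_iff)
next
  case (Cons u us)
  obtain A As' where As: "As = A # As'"
    using Cons.prems by (cases As) auto
  let ?D = "\<lambda>x. {xs. x # xs \<in> S}"
  define c where "c ks = card {x. thick s ks (?D x)}" for ks
  have A: "finite A" "card A = q" using Cons.prems As by auto
  have sub: "{x. thick s ks (?D x)} \<subseteq> A" for ks
    using thick_successors[OF \<open>s > 0\<close>, of S A As'] Cons.prems As by auto
  have fin: "finite {x. thick s ks (?D x)}" for ks
    using sub A finite_subset by blast
  have cq: "c ks \<le> q" for ks
    unfolding c_def using card_mono[OF A(1) sub] A by simp
  have cpos: "c ks > 0 \<longleftrightarrow> (\<exists>x. thick s ks (?D x))" for ks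
    unfolding c_def using fin by (auto simp: card_gt_0_iff)
  have finD: "finite (?D x)" for x
    by (rule finite_imageD[of "(#) x"])
      (auto intro: finite_subset[OF _ Cons.prems(4)] simp: inj_on_def)
  have "real (card S) = (\<Sum>x\<in>A. real (card (?D x)))"
    using card_lists_split[of S A As'] Cons.prems As by simp
  also have "\<dots> \<le> (\<Sum>x\<in>A. real q ^ length us * avg p us (\<lambda>ks. of_bool (thick s ks (?D x))))"
    by (intro sum_mono Cons.IH[of _ As']) (use Cons.prems As finD in auto)
  also have "\<dots> = real q ^ length us * avg p us (\<lambda>ks. \<Sum>x\<in>A. of_bool (thick s ks (?D x)))"
    by (simp add: avg_sum sum_distrib_left)
  also have "(\<lambda>ks. \<Sum>x\<in>A. of_bool (thick s ks (?D x))) = (\<lambda>ks. real (c ks))"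
  proof
    fix ks
    have "A \<inter> {x. thick s ks (?D x)} = {x. thick s ks (?D x)}" using sub by blast
    then show "(\<Sum>x\<in>A. of_bool (thick s ks (?D x))) = real (c ks)"
      using A by (simp add: c_def of_bool_def sum.If_cases)
  qed
  finally have S: "real (card S) \<le> real q ^ length us * avg p us (\<lambda>ks. real (c ks))" .
  have "avg p us (\<lambda>ks. real (c ks)) \<le> real q * avg p (u # us) (\<lambda>ks. of_bool (thick s ks S))"
  proof (cases u)
    case True
    have "avg p us (\<lambda>ks. real (c ks)) \<le>
      avg p us (\<lambda>ks. real q * (p * of_bool (thick s (True # ks) S) +
        (1 - p) * of_bool (thick s (False # ks) S)))"
    proof (intro avg_mono p)
      fix ks
      \<comment> \<open>The right-hand side is \<open>0\<close>, \<open>(1 - p) * q\<close> or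
        \<open>q\<close> respectively: with too few children only the unflagged term survives, and
        \<open>c ks <= s - 1 <= (1 - p) * q\<close>.\<close>
      consider "c ks = 0" | "0 < c ks" "c ks < s" | "s \<le> c ks" by linarith
      then show "real (c ks) \<le> real q * (p * of_bool (thick s (True # ks) S) +
        (1 - p) * of_bool (thick s (False # ks) S))"
      proof cases
        case 1 then show ?thesis using p by simp
      next
        case 2
        then have "real (c ks) \<le> real s - 1" by linarith
        with 2 p show ?thesis using cpos[of ks] by (simp add: c_def[symmetric] mult.commute)
      next
        case 3
        then have "0 < c ks" using \<open>s > 0\<close> by simp
        with 3 show ?thesis using cpos[of ks] cq[of ks] by (simp add: c_def[symmetric])
      qed
    qed
    then show ?thesis using True by (simp add: avg_cmult avg_add)
  next
    case False
    have "avg p us (\<lambda>ks. real (c ks)) \<le> avg p us (\<lambda>ks. real q * of_bool (thick s (False # ks) S))"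
    proof (intro avg_mono p)
      fix ks
      show "real (c ks) \<le> real q * of_bool (thick s (False # ks) S)"
        using cpos[of ks] cq[of ks] by (cases "c ks = 0") auto
    qed
    then show ?thesis using False by (simp add: avg_cmult)
  qed
  then have "real q ^ length us * avg p us (\<lambda>ks. real (c ks)) \<le>
    real q ^ length us * (real q * avg p (u # us) (\<lambda>ks. of_bool (thick s ks S)))"
    by (intro mult_left_mono) auto
  with S show ?case by (simp add: mult_ac del: avg.simps)
qed

text \<open>Both trees are descended together. At a flagged level each offers at least
  \<open>s\<close> children, all inside \<open>As ! i \<union> Bs ! i\<close>; if that union has
  fewer than \<open>2 * s\<close> elements, some child is common. At the other levels the children
  are chosen independently.\<close>

lemma thick_matching:
  assumes "thick s ks S" "thick s ks T" "s > 0"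
    "S \<subseteq> {xs. list_all2 (\<in>) xs As}" "T \<subseteq> {xs. list_all2 (\<in>) xs Bs}"
    "\<forall>A\<in>set As. finite A" "\<forall>B\<in>set Bs. finite B" "length As = length ks" "length Bs = length ks"
  shows "\<exists>xs\<in>S. \<exists>ys\<in>T. \<forall>i<length ks. ks ! i \<and> card (As ! i \<union> Bs ! i) < 2 * s \<longrightarrow> xs ! i = ys ! i"
  using assms(1,2,4-)
proof (induction ks arbitrary: S T As Bs)
  case (Cons k ks)
  obtain A As' B Bs' where As: "As = A # As'" and Bs: "Bs = B # Bs'"
    using Cons.prems by (cases As; cases Bs) auto
  let ?X = "{x. thick s ks {xs. x # xs \<in> S}}" and ?Y = "{x. thick s ks {xs. x # xs \<in> T}}"
  have X: "?X \<subseteq> A" and Y: "?Y \<subseteq> B"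
    using thick_successors[OF \<open>s > 0\<close>] Cons.prems As Bs by blast+
  have fin: "finite A" "finite B" using Cons.prems As Bs by auto
  have "\<exists>x\<in>?X. \<exists>y\<in>?Y. k \<and> card (A \<union> B) < 2 * s \<longrightarrow> x = y"
  proof (cases "k \<and> card (A \<union> B) < 2 * s")
    case True
    then have "s \<le> card ?X" "s \<le> card ?Y" using Cons.prems by auto
    moreover have "card (?X \<union> ?Y) \<le> card (A \<union> B)"
      using X Y fin by (intro card_mono) auto
    moreover have "card (?X \<union> ?Y) + card (?X \<inter> ?Y) = card ?X + card ?Y"
      using X Y fin by (metis card_Un_Int finite_subset)
    ultimately have "card (?X \<inter> ?Y) > 0" using True by linarith
    then obtain x where "x \<in> ?X \<inter> ?Y" by (metis card_gt_0_iff ex_in_conv)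
    then show ?thesis by blast
  next
    case False
    have "?X \<noteq> {}" "?Y \<noteq> {}"
      using Cons.prems(1,2) \<open>s > 0\<close> by (auto split: if_splits dest: order.strict_trans2)
    with False show ?thesis by blast
  qed
  then obtain x y where x: "thick s ks {xs. x # xs \<in> S}" and y: "thick s ks {xs. y # xs \<in> T}"
    and xy: "k \<and> card (A \<union> B) < 2 * s \<longrightarrow> x = y" by blast
  have "\<exists>xs\<in>{xs. x # xs \<in> S}. \<exists>ys\<in>{xs. y # xs \<in> T}. \<forall>i<length ks.
    ks ! i \<and> card (As' ! i \<union> Bs' ! i) < 2 * s \<longrightarrow> xs ! i = ys ! i"
    by (rule Cons.IH) (use x y Cons.prems As Bs in auto)
  then obtain xs ys where xs: "x # xs \<in> S" "y # ys \<in> T"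
    and *: "\<forall>i<length ks. ks ! i \<and> card (As' ! i \<union> Bs' ! i) < 2 * s \<longrightarrow> xs ! i = ys ! i" by blast
  have "\<forall>i<length (k # ks). (k # ks) ! i \<and> card (As ! i \<union> Bs ! i) < 2 * s \<longrightarrow>
    (x # xs) ! i = (y # ys) ! i"
    using * xy As Bs by (auto simp: nth_Cons split: nat.splits)
  with xs show ?case by blast
qed auto

text \<open>Serves the degenerate case in which no level of the protocol is walked and the sets are
  still complete products.\<close>

lemma thick_full:
  assumes "\<forall>A\<in>set As. finite A \<and> s \<le> card A" "s > 0" "length As = length ks"
  shows "thick s ks {xs. list_all2 (\<in>) xs As}"
  using assms(1,3)
proof (induction ks arbitrary: As)
  case (Cons k ks)
  obtain A As' where As: "As = A # As'" using Cons.prems by (cases As) auto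
  have *: "thick s ks {xs. list_all2 (\<in>) xs As'}"
    using Cons As by auto
  have "A \<noteq> {}" "s \<le> card A" using Cons.prems As \<open>s > 0\<close> by auto
  have "{x. thick s ks {xs. x \<in> A \<and> list_all2 (\<in>) xs As'}} = A"
    using * thick_nonempty[OF _ \<open>s > 0\<close>] by fastforce
  then show ?case
    using As \<open>A \<noteq> {}\<close> \<open>s \<le> card A\<close> by auto
qed simp

section \<open>Families without nearly complementary members\<close>

lemma family_split_card:
  assumes "finite V" "v \<notin> V" "F \<subseteq> Pow (insert v V)"
  shows "card F = card {S \<in> F. v \<notin> S} + card {S \<in> Pow V. insert v S \<in> F}"
proof -
  have fin: "finite F" using assms finite_subset by blast
  have "{S \<in> F. v \<in> S} = insert v ` {S \<in> Pow V. insert v S \<in> F}"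
  proof (intro equalityI subsetI)
    fix S assume "S \<in> {S \<in> F. v \<in> S}"
    then have "S - {v} \<in> {S \<in> Pow V. insert v S \<in> F}" "S = insert v (S - {v})"
      using assms by (auto simp: insert_absorb)
    then show "S \<in> insert v ` {S \<in> Pow V. insert v S \<in> F}" by blast
  qed auto
  moreover have "inj_on (insert v) {S \<in> Pow V. insert v S \<in> F}"
    using assms(2) by (intro inj_onI) (metis (mono_tags, lifting) PowD insert_ident mem_Collect_eq subsetD)
  ultimately have "card {S \<in> F. v \<in> S} = card {S \<in> Pow V. insert v S \<in> F}"
    by (simp add: card_image)
  moreover have "card F = card {S \<in> F. v \<notin> S} + card {S \<in> F. v \<in> S}"
    using fin by (subst card_Un_disjoint[symmetric]) (auto intro: arg_cong[where f=card])
  ultimately show ?thesis by simp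
qed

text \<open>The two cross terms have the same product as the two straight ones, which is what makes the
  constant as small as \<open>2 + r + 1 / r\<close>.\<close>
lemma cross_terms:
  fixes x y :: real
  assumes "0 < r" "r \<le> 1" "0 \<le> x" "0 \<le> y" "x \<le> M / r" "y \<le> M / r" "x * y \<le> M ^ 2" "0 \<le> M"
  shows "x + y \<le> M * (r + 1 / r)"
proof (cases "M = 0")
  case False
  then have M: "M > 0" using assms by simp
  have main: "x + y \<le> M * (r + 1 / r)" if "x \<ge> y" "x \<le> M / r" "x * y \<le> M ^ 2" "0 \<le> y" "0 \<le> x" for x y
  proof (cases "x \<le> M")
    case True
    have "0 \<le> (r - 1)\<^sup>2 / r" using assms by simp
    also have "(r - 1)\<^sup>2 / r = r + 1 / r - 2" using assms by (simp add: power2_eq_square field_simps)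
    finally have "M * 2 \<le> M * (r + 1 / r)" using M by (intro mult_left_mono) auto
    with True that show ?thesis by linarith
  next
    case False
    have xp: "x > 0" "x \<ge> M" using False M by auto
    have "y \<le> M^2 / x" using that xp by (simp add: field_simps)
    moreover have "x + M^2 / x \<le> M * (r + 1 / r)"
    proof -
      \<comment> \<open>\<open>r * M\<close> and \<open>M / r\<close> are the two roots of
        \<open>x + M^2 / x = M * (r + 1 / r)\<close>, and \<open>x\<close> lies between
        them.\<close>
      have rx: "r * x \<le> M" using that assms by (simp add: field_simps)
      have "r * M \<le> x"
        using xp assms M by (meson mult_left_le_one_le less_imp_le order_trans)
      with rx have "0 \<le> (M - r * x) * (x - r * M)" by simp
      also have "\<dots> = r * x * (M * (r + 1 / r) - (x + M^2 / x))"
        using xp assms by (simp add: field_simps power2_eq_square)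
      finally have "0 \<le> M * (r + 1 / r) - (x + M^2 / x)"
        using mult_pos_pos[OF \<open>0 < r\<close> xp(1)] zero_le_mult_iff by (metis not_less)
      then show ?thesis by linarith
    qed
    ultimately show ?thesis by linarith
  qed
  show ?thesis
    using main[of x y] main[of y x] assms by (cases "x \<ge> y") (auto simp: mult.commute add.commute)
qed (use assms in auto)

text \<open>Induction on the ground set: pairs that agree on \<open>v\<close> keep distance
  \<open>d\<close> in the rest, pairs that disagree keep \<open>d - 1\<close>, at a cost of
  \<open>1 / r\<close>. Bounding the cross terms separately would give the constant
  \<open>2 + 2 / r\<close>, which for \<open>r = 1 - e\<close> exceeds 4 by a term linear in
  \<open>e\<close> and would drown the gain \<open>r ^ d\<close>; in \<open>2 + r + 1 / r\<close>
  the linear terms cancel.\<close>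

lemma distant_families:
  assumes "finite V" "0 < r" "r \<le> (1::real)" "F \<subseteq> Pow V" "H \<subseteq> Pow V"
    "\<And>S T. S \<in> F \<Longrightarrow> T \<in> H \<Longrightarrow> d \<le> card (S - T \<union> (T - S))"
  shows "real (card F) * real (card H) \<le> (2 + r + 1 / r) ^ card V * r ^ d"
  using assms(1,4-)
proof (induction V arbitrary: F H d rule: finite_induct)
  case empty
  show ?case
  proof (cases "F = {} \<or> H = {}")
    case False
    then have "F = {{}}" "H = {{}}" using empty by auto
    with empty show ?thesis by auto
  qed (use assms in auto)
next
  case (insert v V)
  let ?F0 = "{S \<in> F. v \<notin> S}" and ?F1 = "{S \<in> Pow V. insert v S \<in> F}"
  let ?H0 = "{S \<in> H. v \<notin> S}" and ?H1 = "{S \<in> Pow V. insert v S \<in> H}"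
  define M where "M = (2 + r + 1 / r) ^ card V * r ^ d"
  have cross: "(2 + r + 1 / r) ^ card V * r ^ (d - 1) \<le> M / r"
  proof -
    \<comment> \<open>For \<open>d = 0\<close> the truncated \<open>d - 1\<close> is 0 again, and
      \<open>r \<le> 1\<close> closes the gap.\<close>
    have "r ^ (d - 1) \<le> r ^ d / r"
      using assms(2,3) by (cases d) auto
    then have "(2 + r + 1 / r) ^ card V * r ^ (d - 1) \<le> (2 + r + 1 / r) ^ card V * (r ^ d / r)"
      using assms(2) by (intro mult_left_mono) auto
    then show ?thesis by (simp add: M_def)
  qed
  have sub: "?F0 \<subseteq> Pow V" "?H0 \<subseteq> Pow V" "?F1 \<subseteq> Pow V" "?H1 \<subseteq> Pow V"
    using insert.prems by blast+
  have 00: "real (card ?F0) * real (card ?H0) \<le> M"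
    unfolding M_def by (rule insert.IH) (use insert.prems sub in auto)
  have 11: "real (card ?F1) * real (card ?H1) \<le> M"
    unfolding M_def
  proof (rule insert.IH)
    fix S T assume "S \<in> ?F1" "T \<in> ?H1"
    then show "d \<le> card (S - T \<union> (T - S))"
      using insert.prems(3)[of "insert v S" "insert v T"] insert.hyps
      by (metis (no_types, lifting) Diff_insert2 Diff_insert_absorb insert_Diff1 insertI1
          mem_Collect_eq PowD subsetD Diff_insert)
  qed (use sub in auto)
  have 01: "real (card ?F0) * real (card ?H1) \<le> (2 + r + 1 / r) ^ card V * r ^ (d - 1)"
  proof (rule insert.IH)
    fix S T assume *: "S \<in> ?F0" "T \<in> ?H1"
    then have "d \<le> card (S - insert v T \<union> (insert v T - S))"
      using insert.prems(3)[of "S" "insert v T"] by auto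
    also have "S - insert v T \<union> (insert v T - S) = insert v (S - T \<union> (T - S))"
      using * by auto
    also have "card \<dots> \<le> Suc (card (S - T \<union> (T - S)))"
      by (rule card_insert_le_m1) auto
    finally show "d - 1 \<le> card (S - T \<union> (T - S))" by simp
  qed (use sub in auto)
  have 10: "real (card ?F1) * real (card ?H0) \<le> (2 + r + 1 / r) ^ card V * r ^ (d - 1)"
  proof (rule insert.IH)
    fix S T assume *: "S \<in> ?F1" "T \<in> ?H0"
    then have "d \<le> card (insert v S - T \<union> (T - insert v S))"
      using insert.prems(3)[of "insert v S" T] by auto
    also have "insert v S - T \<union> (T - insert v S) = insert v (S - T \<union> (T - S))"
      using * by auto
    also have "card \<dots> \<le> Suc (card (S - T \<union> (T - S)))"
      by (rule card_insert_le_m1) auto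
    finally show "d - 1 \<le> card (S - T \<union> (T - S))" by simp
  qed (use sub in auto)
  have "(real (card ?F0) * real (card ?H1)) * (real (card ?F1) * real (card ?H0)) =
      (real (card ?F0) * real (card ?H0)) * (real (card ?F1) * real (card ?H1))"
    by (simp add: mult_ac)
  also have "\<dots> \<le> M * M"
    by (intro mult_mono 00 11) (use assms M_def in auto)
  finally have "real (card ?F0) * real (card ?H1) + real (card ?F1) * real (card ?H0) \<le> M * (r + 1 / r)"
    using 01 10 cross assms M_def by (intro cross_terms) (auto simp: power2_eq_square)
  with 00 11 have "(real (card ?F0) + real (card ?F1)) * (real (card ?H0) + real (card ?H1))
      \<le> M * (2 + r + 1 / r)"
    by (simp add: algebra_simps)
  then have "real (card F) * real (card H) \<le> M * (2 + r + 1 / r)"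
    using family_split_card[OF insert.hyps insert.prems(1)]
      family_split_card[OF insert.hyps insert.prems(2)] by simp
  then show ?case
    using insert.hyps by (simp add: M_def mult_ac)
qed

text \<open>Complementing one copy of \<open>F\<close> turns agreement into symmetric difference, so
  otherwise \<open>F\<close> and its complements have distance at least \<open>e * N\<close>. With
  \<open>r = 1 - e\<close> the constant is \<open>4 + e^2 / (1 - e)\<close>, at most
  \<open>4 * exp (e^2 / 3)\<close> for \<open>e \<le> 1 / 4\<close>, while \<open>r ^ d\<close>
  gains \<open>exp (- e^2 * N)\<close>; half of the net exponent \<open>2 / 3 * e^2 * N\<close>
  falls to each family.\<close>

lemma nearly_complementary_pair:
  fixes e :: real
  assumes "finite V" "F \<subseteq> Pow V" "0 < e" "e \<le> 1 / 4"
    "real (card F) > 2 ^ card V * exp (- (e\<^sup>2 * card V / 3))"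
  shows "\<exists>S\<in>F. \<exists>T\<in>F. card {v \<in> V. v \<in> S \<longleftrightarrow> v \<in> T} \<le> e * card V"
proof (rule ccontr)
  assume neg: "\<not> ?thesis"
  define N where "N = card V"
  define d where "d = nat \<lceil>e * N\<rceil>"
  define H where "H = (\<lambda>T. V - T) ` F"
  have "inj_on (\<lambda>T. V - T) F" using assms(2) by (intro inj_onI) blast
  then have card_H: "card H = card F" by (simp add: H_def card_image)
  have dist: "d \<le> card (S - T \<union> (T - S))" if "S \<in> F" "T \<in> H" for S T
  proof -
    from \<open>T \<in> H\<close> obtain T' where T': "T' \<in> F" "T = V - T'" unfolding H_def by blast
    have "S - T \<union> (T - S) = {v \<in> V. v \<in> S \<longleftrightarrow> v \<in> T'}"
      using T' that assms(2) by auto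
    moreover have "e * N < card {v \<in> V. v \<in> S \<longleftrightarrow> v \<in> T'}"
      using neg that T' by (auto simp: N_def not_le)
    ultimately show ?thesis
      unfolding d_def by (simp add: ceiling_le_iff nat_le_iff)
  qed
  have "(2 + (1 - e) + 1 / (1 - e)) \<le> 4 * exp (e\<^sup>2 / 3)"
  proof -
    have "2 + (1 - e) + 1 / (1 - e) = 4 + e\<^sup>2 / (1 - e)"
      using assms by (simp add: field_simps power2_eq_square)
    also have "e\<^sup>2 / (1 - e) \<le> e\<^sup>2 / (3 / 4)"
      using assms by (intro divide_left_mono) auto
    also have "4 + e\<^sup>2 / (3 / 4) = 4 * (1 + e\<^sup>2 / 3)" by simp
    also have "\<dots> \<le> 4 * exp (e\<^sup>2 / 3)" by (intro mult_left_mono) (auto intro: exp_ge_add_one_self)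
    finally show ?thesis by simp
  qed
  then have 1: "(2 + (1 - e) + 1 / (1 - e)) ^ N \<le> (4 * exp (e\<^sup>2 / 3)) ^ N"
    using assms by (intro power_mono) auto
  have "(1 - e) ^ d \<le> exp (- e) ^ d"
    using assms exp_ge_add_one_self[of "- e"] by (intro power_mono) auto
  also have "\<dots> = exp (- (e * d))"
    by (simp add: exp_of_nat_mult[symmetric] mult.commute)
  also have "\<dots> \<le> exp (- (e * (e * N)))"
  proof -
    have "e * N \<le> d" unfolding d_def by linarith
    then have "e * (e * N) \<le> e * d" using assms by (intro mult_left_mono) auto
    then show ?thesis by simp
  qed
  finally have 2: "(1 - e) ^ d \<le> exp (- (e\<^sup>2 * N))" by (simp add: power2_eq_square mult_ac)
  have "real (card F) * real (card F) \<le> (2 + (1 - e) + 1 / (1 - e)) ^ N * (1 - e) ^ d"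
    using distant_families[of V "1 - e" F H d] assms dist card_H H_def N_def by auto
  also have "\<dots> \<le> (4 * exp (e\<^sup>2 / 3)) ^ N * exp (- (e\<^sup>2 * N))"
    using 1 2 assms by (intro mult_mono) auto
  also have "\<dots> = (2 ^ N * exp (- (e\<^sup>2 * N / 3))) * (2 ^ N * exp (- (e\<^sup>2 * N / 3)))"
  proof -
    have "exp (e\<^sup>2 / 3) ^ N = exp (N * (e\<^sup>2 / 3))" by (rule exp_of_nat_mult[symmetric])
    moreover have "exp (N * (e\<^sup>2 / 3)) * exp (- (e\<^sup>2 * N)) = exp (- (e\<^sup>2 * N / 3)) * exp (- (e\<^sup>2 * N / 3))"
      by (simp add: exp_add[symmetric] field_simps)
    moreover have "(4::real) ^ N = 2 ^ N * 2 ^ N" by (simp add: power_mult_distrib[symmetric])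
    ultimately show ?thesis by (simp add: power_mult_distrib mult_ac)
  qed
  also have "\<dots> < real (card F) * real (card F)"
    using assms(5) unfolding N_def by (intro mult_strict_mono') auto
  finally show False by simp
qed

section \<open>Protocols on rectangles\<close>

text \<open>Equality tests identify Alice's input and then Bob's, one candidate at a time. This
  gives the two \<open>LEAST\<close> definitions their meaning.\<close>

lemma solvable:
  fixes R :: "('x, 'y, 'o) comm_problem"
  assumes "finite (alice_inputs R)" "finite (bob_inputs R)"
    "\<And>x y. x \<in> alice_inputs R \<Longrightarrow> y \<in> bob_inputs R \<Longrightarrow> \<exists>z. correct R x y z"
  shows "\<exists>P. solves P R"
proof -
  have bob: "\<exists>P. \<forall>y\<in>B. \<forall>x'::'x. correct R x y (run P x' y)"
    if "finite B" "\<forall>y\<in>B. \<exists>z. correct R x y z" for x B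
    using that
  proof (induction B rule: finite_induct)
    case (insert y B)
    from insert.prems obtain z where "correct R x y z" by auto
    moreover from insert obtain P where "\<forall>y\<in>B. \<forall>x'::'x. correct R x y (run P x' y)" by auto
    ultimately show ?case
      by (intro exI[of _ "Bob (\<lambda>y'. y' = y) (Output z) P"]) auto
  qed auto
  have "\<exists>P. \<forall>x\<in>A. \<forall>y\<in>bob_inputs R. correct R x y (run P x y)"
    if "finite A" "A \<subseteq> alice_inputs R" for A
    using that
  proof (induction A rule: finite_induct)
    case (insert x A)
    then obtain P where P: "\<forall>x\<in>A. \<forall>y\<in>bob_inputs R. correct R x y (run P x y)" by auto
    obtain Q where Q: "\<forall>y\<in>bob_inputs R. \<forall>x'::'x. correct R x y (run Q x' y)"
      using bob[OF assms(2), of x] assms(3) insert.prems by blast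
    show ?case
      by (intro exI[of _ "Alice (\<lambda>x'. x' = x) Q P"]) (use P Q in auto)
  qed auto
  from this[OF assms(1) subset_refl] show ?thesis by (simp add: solves_def)
qed

lemma protocol_size_le: "solves P R \<Longrightarrow> protocol_size R \<le> leaves P"
  unfolding protocol_size_def by (rule Least_le) blast

lemma protocol_size_attained: "solves P R \<Longrightarrow> \<exists>Q. solves Q R \<and> leaves Q = protocol_size R"
  unfolding protocol_size_def by (rule LeastI_ex) blast

lemma CC_attained: "solves P R \<Longrightarrow> \<exists>Q. solves Q R \<and> depth Q = CC R"
  unfolding CC_def by (rule LeastI_ex) blast

lemma finite_cube: "finite (cube n)" "card (cube n) = 2 ^ n"
proof -
  have "cube n = {xs. set xs \<subseteq> UNIV \<and> length xs = n}" by (simp add: cube_def)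
  then show "finite (cube n)" "card (cube n) = 2 ^ n"
    using finite_lists_length_eq[of "UNIV :: bool set" n] card_lists_length_eq[of "UNIV :: bool set" n]
    by simp_all
qed

section \<open>Protocol size of Karchmer-Wigderson relations on rectangles\<close>

definition KW_on :: "nat \<Rightarrow> bool list set \<Rightarrow> bool list set \<Rightarrow> (bool list, bool list, nat) comm_problem" where
  "KW_on m A B = \<lparr> alice_inputs = A, bob_inputs = B, correct = (\<lambda>x y i. i < m \<and> x ! i \<noteq> y ! i) \<rparr>"

lemma KW_eq_KW_on: "KW m f = KW_on m {x \<in> cube m. f x} {y \<in> cube m. \<not> f y}"
  by (simp add: KW_def KW_on_def)

abbreviation rect_size :: "nat \<Rightarrow> bool list set \<Rightarrow> bool list set \<Rightarrow> nat" where
  "rect_size m A B \<equiv> protocol_size (KW_on m A B)"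

text \<open>Disjointness guarantees a differing coordinate for every pair and, unlike being the two
  preimages of \<open>f\<close>, survives shrinking either side.\<close>

definition disjoint_rect :: "nat \<Rightarrow> bool list set \<Rightarrow> bool list set \<Rightarrow> bool" where
  "disjoint_rect m A B \<longleftrightarrow> A \<subseteq> cube m \<and> B \<subseteq> cube m \<and> A \<inter> B = {}"

lemma disjoint_rect_subset:
  "disjoint_rect m A B \<Longrightarrow> A' \<subseteq> A \<Longrightarrow> B' \<subseteq> B \<Longrightarrow> disjoint_rect m A' B'"
  by (auto simp: disjoint_rect_def)

lemma disjoint_rect_swap: "disjoint_rect m A B \<Longrightarrow> disjoint_rect m B A"
  by (auto simp: disjoint_rect_def)

lemma solves_KW_on:
  "solves P (KW_on m A B) \<longleftrightarrow> (\<forall>x\<in>A. \<forall>y\<in>B. run P x y < m \<and> x ! run P x y \<noteq> y ! run P x y)"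
  by (simp add: solves_def KW_on_def)

lemma rect_size_attained:
  assumes "disjoint_rect m A B"
  obtains P where "solves P (KW_on m A B)" "leaves P = rect_size m A B"
proof -
  obtain P0 where "solves P0 (KW_on m A B)"
  proof (atomize_elim, rule solvable)
    have "finite A" "finite B"
      using assms finite_subset[OF _ finite_cube(1)] unfolding disjoint_rect_def by blast+
    then show "finite (alice_inputs (KW_on m A B))" "finite (bob_inputs (KW_on m A B))"
      by (simp_all add: KW_on_def)
    fix x y
    assume "x \<in> alice_inputs (KW_on m A B)" "y \<in> bob_inputs (KW_on m A B)"
    then have "x \<in> A" "y \<in> B" by (simp_all add: KW_on_def)
    then have "length x = m" "length y = m" "x \<noteq> y"
      using assms by (auto simp: disjoint_rect_def cube_def)
    then obtain i where "i < m" "x ! i \<noteq> y ! i" using list_eq_iff_nth_eq[of x y] by auto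
    then show "\<exists>i. correct (KW_on m A B) x y i" by (auto simp: KW_on_def)
  qed
  from protocol_size_attained[OF this] that show ?thesis by auto
qed

primrec swap_roles :: "('x, 'y, 'o) protocol \<Rightarrow> ('y, 'x, 'o) protocol" where
  "swap_roles (Output z) = Output z"
| "swap_roles (Alice b P Q) = Bob b (swap_roles P) (swap_roles Q)"
| "swap_roles (Bob b P Q) = Alice b (swap_roles P) (swap_roles Q)"

lemma run_swap_roles [simp]: "run (swap_roles P) y x = run P x y"
  by (induction P) auto

lemma leaves_swap_roles [simp]: "leaves (swap_roles P) = leaves P"
  by (induction P) auto

lemma rect_size_swap:
  assumes "disjoint_rect m A B"
  shows "rect_size m A B = rect_size m B A"
proof -
  have "rect_size m B A \<le> rect_size m A B" if AB: "disjoint_rect m A B" for A B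
  proof -
    obtain P where "solves P (KW_on m A B)" "leaves P = rect_size m A B"
      using rect_size_attained[OF AB] .
    moreover from this(1) have "solves (swap_roles P) (KW_on m B A)"
      by (fastforce simp: solves_KW_on)
    ultimately show ?thesis using protocol_size_le by (metis leaves_swap_roles)
  qed
  with assms disjoint_rect_swap show ?thesis by (blast intro: antisym)
qed

lemma rect_size_mono:
  assumes "disjoint_rect m A B" "A' \<subseteq> A" "B' \<subseteq> B"
  shows "rect_size m A' B' \<le> rect_size m A B"
proof -
  obtain P where P: "solves P (KW_on m A B)" "leaves P = rect_size m A B"
    using rect_size_attained[OF assms(1)] .
  then have "solves P (KW_on m A' B')" using assms(2,3) by (auto simp: solves_KW_on)
  with P show ?thesis using protocol_size_le by metis
qed

text \<open>Subadditivity is why hardness is measured by size rather than depth: one bit splits the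
  hardness additively, so some answer keeps at least half of it.\<close>

lemma rect_size_split_alice:
  assumes "disjoint_rect m A B"
  shows "rect_size m A B \<le> rect_size m {a \<in> A. p a} B + rect_size m {a \<in> A. \<not> p a} B"
proof -
  have "disjoint_rect m {a \<in> A. p a} B" "disjoint_rect m {a \<in> A. \<not> p a} B"
    by (rule disjoint_rect_subset[OF assms]; blast)+
  note rects = this
  obtain P where P: "solves P (KW_on m {a \<in> A. p a} B)" "leaves P = rect_size m {a \<in> A. p a} B"
    using rect_size_attained[OF rects(1)] .
  obtain Q where Q: "solves Q (KW_on m {a \<in> A. \<not> p a} B)"
    "leaves Q = rect_size m {a \<in> A. \<not> p a} B"
    using rect_size_attained[OF rects(2)] .
  have "solves (Alice p P Q) (KW_on m A B)" using P(1) Q(1) by (simp add: solves_KW_on)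
  from protocol_size_le[OF this] P(2) Q(2) show ?thesis by simp
qed

lemma rect_size_split_bob:
  assumes "disjoint_rect m A B"
  shows "rect_size m A B \<le> rect_size m A {b \<in> B. p b} + rect_size m A {b \<in> B. \<not> p b}"
proof -
  have "disjoint_rect m A {b \<in> B. p b}" "disjoint_rect m A {b \<in> B. \<not> p b}"
    by (rule disjoint_rect_subset[OF assms]; blast)+
  with rect_size_split_alice[OF disjoint_rect_swap[OF assms], of p] show ?thesis
    by (simp add: rect_size_swap[OF assms] rect_size_swap[of m A "{b \<in> B. p b}"]
        rect_size_swap[of m A "{b \<in> B. \<not> p b}"])
qed

text \<open>Alice names the first \<open>k\<close> that is good for her. The sets of good inputs may
  overlap, and monotonicity replaces the not yet served part of \<open>A\<close> by all of
  \<open>A\<close>.\<close>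

lemma rect_size_cover:
  assumes "finite F" "F \<noteq> {}" "disjoint_rect m A B" "\<forall>a\<in>A. \<exists>k\<in>F. good a k"
  shows "rect_size m A B \<le> (\<Sum>k\<in>F. rect_size m {a \<in> A. good a k} B)"
  using assms
proof (induction F arbitrary: A rule: finite_ne_induct)
  case (singleton k)
  then have "{a \<in> A. good a k} = A" by auto
  then show ?case by simp
next
  case (insert k F)
  let ?N = "{a \<in> A. \<not> good a k}"
  have N: "disjoint_rect m ?N B"
    by (rule disjoint_rect_subset[OF insert.prems(1)]) auto
  have "rect_size m A B \<le> rect_size m {a \<in> A. good a k} B + rect_size m ?N B"
    by (rule rect_size_split_alice[OF insert.prems(1)])
  also have "rect_size m ?N B \<le> (\<Sum>k\<in>F. rect_size m {a \<in> ?N. good a k} B)"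
    by (rule insert.IH[OF N]) (use insert.prems in auto)
  also have "\<dots> \<le> (\<Sum>k\<in>F. rect_size m {a \<in> A. good a k} B)"
    by (intro sum_mono rect_size_mono disjoint_rect_subset[OF insert.prems(1)]) auto
  finally show ?case using insert.hyps by simp
qed

lemma rect_size_constant_answer:
  assumes "\<forall>a\<in>A. \<forall>b\<in>B. i < m \<and> a ! i \<noteq> b ! i"
  shows "rect_size m A B \<le> 1"
  using protocol_size_le[of "Output i" "KW_on m A B"] assms by (simp add: solves_KW_on)

text \<open>Both players reveal coordinate \<open>i\<close>: if the bits differ, \<open>i\<close> is
  the answer, otherwise the search goes on in the remaining set. The recurrence
  \<open>L = 2 * (L' + 1)\<close> reads \<open>L + 2 = 2 * (L' + 2)\<close>, which explains the
  shift by 2. Its contrapositive finds \<open>a\<close>, \<open>b\<close> that agree on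
  \<open>I\<close>.\<close>

lemma rect_size_differ_within:
  assumes "finite I" "I \<subseteq> {..<m}" "disjoint_rect m A B" "\<forall>a\<in>A. \<forall>b\<in>B. \<exists>i\<in>I. a ! i \<noteq> b ! i"
  shows "rect_size m A B + 2 \<le> 3 * 2 ^ card I"
  using assms
proof (induction I arbitrary: A B rule: finite_induct)
  case empty
  then have "rect_size m A B \<le> 1" by (intro rect_size_constant_answer[of _ _ 0]) auto
  then show ?case by simp
next
  case (insert i I)
  have same: "rect_size m {a \<in> A. a ! i = c} {b \<in> B. b ! i = c} + 2 \<le> 3 * 2 ^ card I" for c
  proof (rule insert.IH)
    show "\<forall>a\<in>{a \<in> A. a ! i = c}. \<forall>b\<in>{b \<in> B. b ! i = c}. \<exists>i\<in>I. a ! i \<noteq> b ! i"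
      using insert.prems(3) by fastforce
  qed (use insert.prems in \<open>auto intro: disjoint_rect_subset\<close>)
  have diff: "rect_size m {a \<in> A. a ! i = c} {b \<in> B. b ! i = (\<not> c)} \<le> 1" for c
    using insert.prems by (intro rect_size_constant_answer[of _ _ i]) auto
  have half: "rect_size m {a \<in> A. a ! i = c} B + 1 \<le> 3 * 2 ^ card I" for c
  proof -
    have "rect_size m {a \<in> A. a ! i = c} B \<le> rect_size m {a \<in> A. a ! i = c} {b \<in> B. b ! i = c} +
      rect_size m {a \<in> A. a ! i = c} {b \<in> B. \<not> b ! i = c}"
      by (rule rect_size_split_bob) (use insert.prems(2) in \<open>auto intro: disjoint_rect_subset\<close>)
    moreover have "{b \<in> B. \<not> b ! i = c} = {b \<in> B. b ! i = (\<not> c)}" by auto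
    ultimately show ?thesis using same[of c] diff[of c] by simp
  qed
  have "rect_size m A B \<le> rect_size m {a \<in> A. a ! i = True} B + rect_size m {a \<in> A. a ! i = False} B"
    using rect_size_split_alice[OF insert.prems(2), of "\<lambda>a. a ! i = True"] by simp
  with half[of True] half[of False] insert.hyps show ?case by simp
qed

section \<open>Walking down a protocol with majority bits\<close>

lemma half_card:
  assumes "finite S"
  shows "card S \<le> 2 * card {X \<in> S. p X} \<or> card S \<le> 2 * card {X \<in> S. \<not> p X}"
proof -
  have "card S = card {X \<in> S. p X} + card {X \<in> S. \<not> p X}"
    using assms by (subst card_Un_disjoint[symmetric]) (auto intro: arg_cong[where f=card])
  then show ?thesis by linarith
qed

text \<open>The bits of the two speakers are counted separately because only Alice's bits thin out
  her matrices, and likewise for Bob; since just the sum is bounded by \<open>t\<close>, both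
  densities together cost \<open>2 ^ t\<close> later, not \<open>2 ^ (2 * t)\<close>. Truncated
  subtraction in \<open>depth P - t\<close> covers walks that meet a leaf early.\<close>

definition walked ::
    "nat \<Rightarrow> nat \<Rightarrow> ('x, 'y, 'o) protocol \<Rightarrow> bool list set \<Rightarrow> bool list set \<Rightarrow> (bool list \<Rightarrow> 'x set) \<Rightarrow>
      (bool list \<Rightarrow> 'y set) \<Rightarrow> ('x, 'y, 'o) protocol \<Rightarrow> bool list set \<Rightarrow> bool list set \<Rightarrow>
      (bool list \<Rightarrow> 'x set) \<Rightarrow> (bool list \<Rightarrow> 'y set) \<Rightarrow> nat \<Rightarrow> nat \<Rightarrow> bool" where
  "walked m t P A B S T Q A' B' S' T' tA tB \<longleftrightarrow>
    depth Q \<le> depth P - t \<and> A' \<subseteq> A \<and> B' \<subseteq> B \<and> tA + tB \<le> t \<and>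
    rect_size m A B \<le> 2 ^ t * rect_size m A' B' \<and>
    (\<forall>a\<in>A'. S' a \<subseteq> S a \<and> card (S a) \<le> 2 ^ tA * card (S' a)) \<and>
    (\<forall>b\<in>B'. T' b \<subseteq> T b \<and> card (T b) \<le> 2 ^ tB * card (T' b)) \<and>
    (\<forall>a\<in>A'. \<forall>b\<in>B'. \<forall>X\<in>S' a. \<forall>Y\<in>T' b. run Q X Y = run P X Y)"

lemma walked_trans:
  assumes "walked m 1 P A B S T Q A' B' S' T' tA tB"
    "walked m t Q A' B' S' T' Q' A'' B'' S'' T'' tA' tB'"
  shows "walked m (Suc t) P A B S T Q' A'' B'' S'' T'' (tA + tA') (tB + tB')"
proof -
  have 1: "rect_size m A B \<le> 2 ^ Suc t * rect_size m A'' B''"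
    using assms unfolding walked_def by fastforce
  have 2: "card (S a) \<le> 2 ^ (tA + tA') * card (S'' a)" if "a \<in> A''" for a
  proof -
    have "card (S a) \<le> 2 ^ tA * card (S' a)" "card (S' a) \<le> 2 ^ tA' * card (S'' a)"
      using assms that unfolding walked_def by blast+
    then have "card (S a) \<le> 2 ^ tA * (2 ^ tA' * card (S'' a))"
      by (meson le_trans mult_le_mono2)
    then show ?thesis by (simp add: power_add mult.assoc)
  qed
  have 3: "card (T b) \<le> 2 ^ (tB + tB') * card (T'' b)" if "b \<in> B''" for b
  proof -
    have "card (T b) \<le> 2 ^ tB * card (T' b)" "card (T' b) \<le> 2 ^ tB' * card (T'' b)"
      using assms that unfolding walked_def by blast+
    then have "card (T b) \<le> 2 ^ tB * (2 ^ tB' * card (T'' b))"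
      by (meson le_trans mult_le_mono2)
    then show ?thesis by (simp add: power_add mult.assoc)
  qed
  have 4: "run Q' X Y = run P X Y" if "a \<in> A''" "b \<in> B''" "X \<in> S'' a" "Y \<in> T'' b" for a b X Y
  proof -
    have "a \<in> A'" "b \<in> B'" "X \<in> S' a" "Y \<in> T' b"
      using assms that unfolding walked_def by blast+
    then have "run Q X Y = run P X Y" using assms unfolding walked_def by blast
    moreover have "run Q' X Y = run Q X Y" using assms that unfolding walked_def by blast
    ultimately show ?thesis by simp
  qed
  have 5: "A'' \<subseteq> A" "B'' \<subseteq> B" "\<forall>a\<in>A''. S'' a \<subseteq> S a" "\<forall>b\<in>B''. T'' b \<subseteq> T b"
    using assms unfolding walked_def by blast+
  have 6: "depth Q' \<le> depth P - Suc t" "tA + tA' + (tB + tB') \<le> Suc t"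
    using assms unfolding walked_def by linarith+
  show ?thesis
    unfolding walked_def using 1 2 3 4 5 6 by blast
qed

text \<open>Each speaker sends the bit that keeps the majority of the matrices still consistent with
  his or her column vector; read on the column vectors alone, this is a protocol for \<open>KW\<^sub>f\<close>.\<close>
lemma walk_one:
  assumes "disjoint_rect m A B" "\<forall>a\<in>A. finite (S a)" "\<forall>b\<in>B. finite (T b)"
  shows "\<exists>Q A' B' S' T' tA tB. walked m 1 P A B S T Q A' B' S' T' tA tB"
proof (cases P)
  case (Output z)
  \<comment> \<open>At a leaf the walk stands still and no bit is charged.\<close>
  have "walked m 1 P A B S T P A B S T 0 0"
    by (simp add: walked_def Output)
  then show ?thesis by blast
next
  case (Alice p P1 P2)
  define maj where "maj a \<longleftrightarrow> card (S a) \<le> 2 * card {X \<in> S a. p X}" for a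
  have min: "card (S a) \<le> 2 * card {X \<in> S a. \<not> p X}" if "a \<in> A" "\<not> maj a" for a
    using half_card[of "S a" p] assms(2) that unfolding maj_def by blast
  have split: "rect_size m A B \<le> rect_size m {a \<in> A. maj a} B + rect_size m {a \<in> A. \<not> maj a} B"
    by (rule rect_size_split_alice[OF assms(1)])
  show ?thesis
  proof (cases "rect_size m A B \<le> 2 * rect_size m {a \<in> A. maj a} B")
    case True
    then have "walked m 1 P A B S T P1 {a \<in> A. maj a} B (\<lambda>a. {X \<in> S a. p X}) T 1 0"
      by (auto simp: walked_def Alice maj_def)
    then show ?thesis by blast
  next
    case False
    then have "walked m 1 P A B S T P2 {a \<in> A. \<not> maj a} B (\<lambda>a. {X \<in> S a. \<not> p X}) T 1 0"
      using min split by (auto simp: walked_def Alice)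
    then show ?thesis by blast
  qed
next
  case (Bob p P1 P2)
  define maj where "maj b \<longleftrightarrow> card (T b) \<le> 2 * card {Y \<in> T b. p Y}" for b
  have min: "card (T b) \<le> 2 * card {Y \<in> T b. \<not> p Y}" if "b \<in> B" "\<not> maj b" for b
    using half_card[of "T b" p] assms(3) that unfolding maj_def by blast
  have split: "rect_size m A B \<le> rect_size m A {b \<in> B. maj b} + rect_size m A {b \<in> B. \<not> maj b}"
    by (rule rect_size_split_bob[OF assms(1)])
  show ?thesis
  proof (cases "rect_size m A B \<le> 2 * rect_size m A {b \<in> B. maj b}")
    case True
    then have "walked m 1 P A B S T P1 A {b \<in> B. maj b} S (\<lambda>b. {Y \<in> T b. p Y}) 0 1"
      by (auto simp: walked_def Bob maj_def)
    then show ?thesis by blast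
  next
    case False
    then have "walked m 1 P A B S T P2 A {b \<in> B. \<not> maj b} S (\<lambda>b. {Y \<in> T b. \<not> p Y}) 0 1"
      using min split by (auto simp: walked_def Bob)
    then show ?thesis by blast
  qed
qed

lemma walk:
  assumes "disjoint_rect m A B" "\<forall>a\<in>A. finite (S a)" "\<forall>b\<in>B. finite (T b)"
  shows "\<exists>Q A' B' S' T' tA tB. walked m t P A B S T Q A' B' S' T' tA tB"
  using assms
proof (induction t arbitrary: P A B S T)
  case 0
  have "walked m 0 P A B S T P A B S T 0 0"
    by (simp add: walked_def)
  then show ?case by blast
next
  case (Suc t)
  obtain Q A' B' S' T' tA tB where 1: "walked m 1 P A B S T Q A' B' S' T' tA tB"
    using walk_one[OF Suc.prems] by blast
  then have sub: "A' \<subseteq> A" "B' \<subseteq> B" "\<forall>a\<in>A'. S' a \<subseteq> S a" "\<forall>b\<in>B'. T' b \<subseteq> T b"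
    unfolding walked_def by blast+
  have "disjoint_rect m A' B'" by (rule disjoint_rect_subset[OF Suc.prems(1) sub(1,2)])
  moreover have "\<forall>a\<in>A'. finite (S' a)" "\<forall>b\<in>B'. finite (T' b)"
    using Suc.prems(2,3) sub by (meson finite_subset subsetD)+
  ultimately obtain Q' A'' B'' S'' T'' tA' tB'
    where "walked m t Q A' B' S' T' Q' A'' B'' S'' T'' tA' tB'"
    using Suc.IH[of A' B' S' T' Q] by blast
  from walked_trans[OF 1 this] show ?case by blast
qed

section \<open>Announcing rows from a small list of candidates\<close>

text \<open>Greedy covering: by averaging, some flag vector is good for a fraction
  \<open>\<alpha>\<close> of the inputs not yet served, so each round shrinks these by
  \<open>1 - \<alpha>\<close>.\<close>

lemma flag_cover:
  assumes "finite A" "0 \<le> p" "p \<le> 1" "\<alpha> \<le> 1"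
    "\<forall>a\<in>A. \<alpha> \<le> avg p us (\<lambda>ks. of_bool (good a ks))"
  shows "\<exists>F. finite F \<and> card F \<le> R \<and> (\<forall>ks\<in>F. subflags ks us) \<and>
    real (card {a \<in> A. \<forall>ks\<in>F. \<not> good a ks}) \<le> (1 - \<alpha>) ^ R * card A"
proof (induction R)
  case 0
  show ?case by (intro exI[of _ "{}"]) auto
next
  case (Suc R)
  then obtain F where F: "finite F" "card F \<le> R" "\<forall>ks\<in>F. subflags ks us"
    "real (card {a \<in> A. \<forall>ks\<in>F. \<not> good a ks}) \<le> (1 - \<alpha>) ^ R * card A" by blast
  define U where "U = {a \<in> A. \<forall>ks\<in>F. \<not> good a ks}"
  have fin: "finite U" using assms(1) by (simp add: U_def)
  obtain ks where ks: "subflags ks us"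
    "avg p us (\<lambda>ks. \<Sum>a\<in>U. of_bool (good a ks)) \<le> (\<Sum>a\<in>U. of_bool (good a ks))"
    using avg_attained[OF assms(2,3)] by blast
  have "\<alpha> * card U = (\<Sum>a\<in>U. \<alpha>)" by simp
  also have "\<dots> \<le> (\<Sum>a\<in>U. avg p us (\<lambda>ks. of_bool (good a ks)))"
    using assms(5) by (intro sum_mono) (auto simp: U_def)
  also have "\<dots> \<le> (\<Sum>a\<in>U. of_bool (good a ks))"
    using ks(2) by (simp add: avg_sum)
  also have "\<dots> = card {a \<in> U. good a ks}"
    using fin by (simp add: of_bool_def sum.If_cases Int_def)
  finally have 1: "\<alpha> * card U \<le> card {a \<in> U. good a ks}" .
  have "card U = card {a \<in> U. good a ks} + card {a \<in> U. \<not> good a ks}"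
    using fin by (subst card_Un_disjoint[symmetric]) (auto intro: arg_cong[where f=card])
  with 1 have "card {a \<in> U. \<not> good a ks} \<le> (1 - \<alpha>) * card U" by (simp add: algebra_simps)
  also have "\<dots> \<le> (1 - \<alpha>) * ((1 - \<alpha>) ^ R * card A)"
    using F(4) assms(4) unfolding U_def by (intro mult_left_mono) auto
  also have "{a \<in> U. \<not> good a ks} = {a \<in> A. \<forall>ks\<in>insert ks F. \<not> good a ks}"
    by (auto simp: U_def)
  finally have "real (card {a \<in> A. \<forall>ks\<in>insert ks F. \<not> good a ks}) \<le> (1 - \<alpha>) ^ Suc R * card A"
    by (simp add: mult_ac)
  moreover have "card (insert ks F) \<le> Suc R" using F by (simp add: card_insert_if)
  ultimately show ?case
    using F ks(1) by (intro exI[of _ "insert ks F"]) auto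
qed

text \<open>About \<open>m / \<alpha>\<close> flag vectors serve all of \<open>A\<close>.  Alice can name one that is good for her input,
  which costs a factor of that size.\<close>
lemma announce_flags:
  fixes good :: "bool list \<Rightarrow> bool list \<Rightarrow> bool"
  assumes rect: "disjoint_rect m A B" and m: "m \<ge> 1" and p: "0 \<le> p" "p \<le> 1" and "0 < \<alpha>" "\<alpha> \<le> 1"
    "\<forall>a\<in>A. \<alpha> \<le> avg p us (\<lambda>ks. of_bool (good a ks))"
  shows "\<exists>ks. subflags ks us \<and>
    real (rect_size m A B) \<le> 2 * m / \<alpha> * real (rect_size m {a \<in> A. good a ks} B)"
proof -
  \<comment> \<open>With this many rounds fewer than \<open>exp (- m) * 2 ^ m < 1\<close> inputs
    remain unserved, hence none.\<close>
  define R where "R = nat \<lceil>m / \<alpha>\<rceil>"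
  have one: "1 \<le> m / \<alpha>" using assms m by (simp add: field_simps)
  have R: "m / \<alpha> \<le> R" "R \<le> 2 * m / \<alpha>" unfolding R_def using one by linarith+
  have A: "A \<subseteq> cube m" using rect by (auto simp: disjoint_rect_def)
  have fin: "finite A" "card A \<le> 2 ^ m"
    using card_mono[OF finite_cube(1) A] finite_subset[OF A] finite_cube by auto
  obtain F where F: "finite F" "card F \<le> R" "\<forall>ks\<in>F. subflags ks us"
    "real (card {a \<in> A. \<forall>ks\<in>F. \<not> good a ks}) \<le> (1 - \<alpha>) ^ R * card A"
    using flag_cover[OF fin(1) p \<open>\<alpha> \<le> 1\<close> assms(7)] by blast
  have "(1 - \<alpha>) ^ R \<le> exp (- \<alpha>) ^ R"
    using \<open>\<alpha> \<le> 1\<close> exp_ge_add_one_self[of "- \<alpha>"] by (intro power_mono) auto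
  also have "\<dots> = exp (- (R * \<alpha>))" by (simp add: exp_of_nat_mult[symmetric])
  also have "\<dots> \<le> exp (- real m)" using R(1) \<open>0 < \<alpha>\<close> by (simp add: field_simps)
  also have "\<dots> = exp (-1) ^ m" by (simp add: exp_of_nat_mult[symmetric])
  also have "\<dots> < (1 / 2) ^ m"
  proof (rule power_strict_mono)
    have "(1 + 1::real) < exp 1" using exp_ge_one_plus_x_over_n_power_n[of 2 1] by (simp add: power2_eq_square)
    then show "exp (-1) < (1 / 2::real)" by (simp add: exp_minus field_simps)
  qed (use m in auto)
  finally have "(1 - \<alpha>) ^ R < (1 / 2) ^ m" .
  then have "(1 - \<alpha>) ^ R * card A < 1"
  proof -
    assume *: "(1 - \<alpha>) ^ R < (1 / 2) ^ m"
    have "(1 - \<alpha>) ^ R * card A \<le> (1 - \<alpha>) ^ R * 2 ^ m"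
      using fin(2) \<open>\<alpha> \<le> 1\<close> by (intro mult_left_mono) (simp_all add: of_nat_le_numeral_power_cancel_iff)
    also have "\<dots> < (1 / 2) ^ m * 2 ^ m" using * by (intro mult_strict_right_mono) auto
    finally show ?thesis by (simp add: power_mult_distrib[symmetric])
  qed
  with F(4) have "card {a \<in> A. \<forall>ks\<in>F. \<not> good a ks} = 0" by linarith
  with fin have covered: "\<forall>a\<in>A. \<exists>ks\<in>F. good a ks" by auto
  show ?thesis
  proof (cases "F = {}")
    case True
    then have "A = {}" using covered by auto
    then have "{a \<in> A. good a us} = A" by auto
    moreover have "1 * real (rect_size m A B) \<le> 2 * m / \<alpha> * real (rect_size m A B)"
      using one by (intro mult_right_mono) auto
    ultimately show ?thesis by (intro exI[of _ us]) (auto simp: list_all2_refl)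
  next
    case False
    have "\<exists>ks\<in>F. real (rect_size m A B) \<le> card F * real (rect_size m {a \<in> A. good a ks} B)"
    proof (rule ccontr)
      assume neg: "\<not> ?thesis"
      have "0 < real (card F)" using F(1) False by (simp add: card_gt_0_iff)
      with neg have *: "real (rect_size m {a \<in> A. good a ks} B) < rect_size m A B / card F"
        if "ks \<in> F" for ks
        using that by (simp add: pos_less_divide_eq mult.commute not_le)
      have "real (rect_size m A B) \<le> (\<Sum>ks\<in>F. real (rect_size m {a \<in> A. good a ks} B))"
        using of_nat_mono[OF rect_size_cover[OF F(1) False rect covered], where 'a = real] by simp
      also have "\<dots> < (\<Sum>ks\<in>F. rect_size m A B / card F)"
        by (rule sum_strict_mono) (use F(1) False * in auto)
      also have "\<dots> = rect_size m A B" using F(1) False by simp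
      finally show False by simp
    qed
    then obtain ks where ks: "ks \<in> F" "real (rect_size m A B) \<le> card F * real (rect_size m {a \<in> A. good a ks} B)"
      by blast
    note ks(2)
    also have "card F * real (rect_size m {a \<in> A. good a ks} B) \<le>
      2 * m / \<alpha> * real (rect_size m {a \<in> A. good a ks} B)"
      using F(2) R(2) by (intro mult_right_mono) auto
    finally show ?thesis
      by (intro exI[of _ ks] conjI bspec[OF F(3) ks(1)]) simp
  qed
qed

section \<open>Formulas of protocols\<close>

datatype formula =
    Const bool
  | Literal nat nat bool bool
  | Conj formula formula
  | Disj formula formula

text \<open>Bits \<open>c\<close> and \<open>c'\<close> of a literal at \<open>(i, j)\<close> record the values of \<open>X\<^sub>i\<^sub>j\<close> and \<open>g(X\<^sub>i)\<close> that are common to all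
  of Alice's matrices reaching a leaf with output \<open>(i, j)\<close>.\<close>
primrec protocol_formula ::
    "(bool list list, bool list list, nat \<times> nat) protocol \<Rightarrow> (bool list \<Rightarrow> bool) \<Rightarrow>
      bool list list set \<Rightarrow> bool list list set \<Rightarrow> formula" where
  "protocol_formula (Output z) g A B =
    (if A = {} then Const False else if B = {} then Const True
     else let X = SOME X. X \<in> A in
      Literal (fst z) (snd z) (X ! fst z ! snd z) (g (X ! fst z)))"
| "protocol_formula (Alice p P Q) g A B =
    Disj (protocol_formula P g {X \<in> A. p X} B) (protocol_formula Q g {X \<in> A. \<not> p X} B)"
| "protocol_formula (Bob p P Q) g A B =
    Conj (protocol_formula P g A {Y \<in> B. p Y}) (protocol_formula Q g A {Y \<in> B. \<not> p Y})"

definition strongly_differ ::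
    "nat \<Rightarrow> nat \<Rightarrow> (bool list \<Rightarrow> bool) \<Rightarrow> bool list list \<Rightarrow> bool list list \<Rightarrow> nat \<times> nat \<Rightarrow> bool" where
  "strongly_differ m n g X Y z \<longleftrightarrow> fst z < m \<and> snd z < n \<and> g (X ! fst z) \<noteq> g (Y ! fst z) \<and>
    X ! fst z ! snd z \<noteq> Y ! fst z ! snd z"

text \<open>The common formula is true on Alice's matrices and false on Bob's.  Following it from the root
  with \<open>X\<close> and \<open>Y\<close> therefore ends in a literal whose row \<open>i\<close> witnesses the claim, although \<open>X\<close> and
  \<open>Y\<close> belong to different inner functions.\<close>
lemma same_formula:
  assumes "\<forall>X\<in>A. \<forall>Y\<in>B. strongly_differ m n g X Y (run P X Y)"
    "\<forall>X\<in>A'. \<forall>Y\<in>B'. strongly_differ m n h X Y (run P' X Y)"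
    "protocol_formula P g A B = protocol_formula P' h A' B'"
    "X \<in> A" "Y \<in> B'"
  shows "\<exists>i<m. g (X ! i) \<noteq> h (Y ! i) \<and> X ! i \<noteq> Y ! i"
  using assms
proof (induction P arbitrary: P' A B A' B')
  case (Output z)
  obtain z' where P': "P' = Output z'"
    using Output.prems(3,4) by (cases P') (auto simp: Let_def split: if_splits)
  \<comment> \<open>\<open>X\<close> excludes \<open>Const False\<close> on the left and
    \<open>Y\<close> excludes \<open>Const True\<close> on the right, so equality forces literals on
    both sides and thereby all four sets to be nonempty.\<close>
  have ne: "A \<noteq> {}" "B \<noteq> {}" "A' \<noteq> {}" "B' \<noteq> {}"
    using Output.prems(3-5) P' by (auto simp: Let_def split: if_splits)
  define X0 where "X0 = (SOME X. X \<in> A)"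
  define X1 where "X1 = (SOME X. X \<in> A')"
  have X01: "X0 \<in> A" "X1 \<in> A'" unfolding X0_def X1_def using ne some_in_eq by blast+
  obtain Y0 where Y0: "Y0 \<in> B" using ne by blast
  have z: "z' = z" "X0 ! fst z ! snd z = X1 ! fst z ! snd z" "g (X0 ! fst z) = h (X1 ! fst z)"
    using Output.prems(3) ne P' by (auto simp: Let_def X0_def X1_def prod_eq_iff)
  \<comment> \<open>Values are bits, so \<open>X\<close> and \<open>X0\<close>, both different from
    \<open>Y0\<close>, coincide at \<open>z\<close>; the literal carries this over to
    \<open>X1\<close>, which differs from \<open>Y\<close>. The same chain works for the entry and
    for the value of the inner function.\<close>
  have "strongly_differ m n g X Y0 z" "strongly_differ m n g X0 Y0 z" "strongly_differ m n h X1 Y z"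
    using Output.prems X01 Y0 P' z by auto
  then have "fst z < m" "g (X ! fst z) \<noteq> h (Y ! fst z)" "X ! fst z ! snd z \<noteq> Y ! fst z ! snd z"
    using z by (auto simp: strongly_differ_def)
  then show ?case by metis
next
  case (Alice p P Q)
  obtain p' P1 Q1 where P': "P' = Alice p' P1 Q1"
    using Alice.prems(3) by (cases P') (auto simp: Let_def split: if_splits)
  show ?case
  \<comment> \<open>Alice's nodes follow \<open>p\<close> of \<open>P\<close>, since
    \<open>X\<close> lives in \<open>A\<close>; Bob's nodes below follow \<open>p'\<close> of
    \<open>P'\<close>, since \<open>Y\<close> lives in \<open>B'\<close>. Thus both memberships
    persist.\<close>
  proof (cases "p X")
    case True
    show ?thesis
      by (rule Alice.IH(1)[of "{X \<in> A. p X}" B "{X \<in> A'. p' X}" B' P1])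
        (use Alice.prems P' True in auto)
  next
    case False
    show ?thesis
      by (rule Alice.IH(2)[of "{X \<in> A. \<not> p X}" B "{X \<in> A'. \<not> p' X}" B' Q1])
        (use Alice.prems P' False in auto)
  qed
next
  case (Bob p P Q)
  obtain p' P1 Q1 where P': "P' = Bob p' P1 Q1"
    using Bob.prems(3) by (cases P') (auto simp: Let_def split: if_splits)
  have eqs: "protocol_formula P g A {Y \<in> B. p Y} = protocol_formula P1 h A' {Y \<in> B'. p' Y}"
    "protocol_formula Q g A {Y \<in> B. \<not> p Y} = protocol_formula Q1 h A' {Y \<in> B'. \<not> p' Y}"
    using Bob.prems(3) P' by simp_all
  have ok: "\<forall>X\<in>A. \<forall>Y\<in>{Y \<in> B. p Y}. strongly_differ m n g X Y (run P X Y)"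
    "\<forall>X\<in>A. \<forall>Y\<in>{Y \<in> B. \<not> p Y}. strongly_differ m n g X Y (run Q X Y)"
    "\<forall>X\<in>A'. \<forall>Y\<in>{Y \<in> B'. p' Y}. strongly_differ m n h X Y (run P1 X Y)"
    "\<forall>X\<in>A'. \<forall>Y\<in>{Y \<in> B'. \<not> p' Y}. strongly_differ m n h X Y (run Q1 X Y)"
    using Bob.prems(1,2) P' by fastforce+
  show ?case
  proof (cases "p' Y")
    case True
    then show ?thesis
      using Bob.IH(1)[OF ok(1,3) eqs(1) Bob.prems(4)] Bob.prems(5) by simp
  next
    case False
    then show ?thesis
      using Bob.IH(2)[OF ok(2,4) eqs(2) Bob.prems(4)] Bob.prems(5) by simp
  qed
qed

section \<open>Counting formulas of bounded depth\<close>

definition leaf_formulas :: "nat \<Rightarrow> nat \<Rightarrow> formula set" where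
  "leaf_formulas m n = insert (Const True) (insert (Const False)
    ((\<lambda>(i, j, c, d). Literal i j c d) ` ({..<m} \<times> {..<n} \<times> UNIV \<times> UNIV)))"

primrec formulas :: "nat \<Rightarrow> nat \<Rightarrow> nat \<Rightarrow> formula set" where
  "formulas m n 0 = leaf_formulas m n"
| "formulas m n (Suc k) = leaf_formulas m n \<union>
    (\<lambda>(P, Q). Conj P Q) ` (formulas m n k \<times> formulas m n k) \<union>
    (\<lambda>(P, Q). Disj P Q) ` (formulas m n k \<times> formulas m n k)"

lemma finite_formulas: "finite (formulas m n k)"
  by (induction k) (auto simp: leaf_formulas_def)

lemma card_leaf_formulas: "card (leaf_formulas m n) \<le> 4 * m * n + 2"
proof -
  let ?L = "(\<lambda>(i, j, c, d). Literal i j c d) ` ({..<m} \<times> {..<n} \<times> (UNIV :: bool set) \<times> (UNIV :: bool set))"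
  have "card ?L \<le> card ({..<m} \<times> {..<n} \<times> (UNIV :: bool set) \<times> (UNIV :: bool set))"
    by (rule card_image_le) auto
  then have "card ?L \<le> 4 * m * n"
    by (simp add: card_cartesian_product card_UNIV_bool del: UNIV_Times_UNIV)
  moreover have "card (leaf_formulas m n) \<le> Suc (Suc (card ?L))"
    unfolding leaf_formulas_def by (simp add: card_insert_if)
  ultimately show ?thesis by linarith
qed

text \<open>There are at most \<open>2 ^ (k + 1) - 1\<close> nodes, each with one of
  \<open>4 * m * n\<close> literals, 2 constants or 2 connectives.\<close>

lemma card_formulas: "card (formulas m n k) \<le> (4 * m * n + 4) ^ (2 ^ (k + 1) - 1)"
proof (induction k)
  case 0
  then show ?case using card_leaf_formulas[of m n] by simp
next
  case (Suc k)
  define b where "b = 4 * m * n + 4"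
  define e :: nat where "e = 2 ^ (k + 1) - 1"
  have e: "2 ^ (Suc k + 1) - 1 = Suc (e + e)"
  proof -
    have "2 ^ (k + 1) = Suc e" unfolding e_def by simp
    then have "2 ^ (Suc k + 1) = 2 * Suc e" by simp
    then show ?thesis by simp
  qed
  let ?C = "(\<lambda>(P, Q). Conj P Q) ` (formulas m n k \<times> formulas m n k)"
  let ?D = "(\<lambda>(P, Q). Disj P Q) ` (formulas m n k \<times> formulas m n k)"
  have IH: "card (formulas m n k) \<le> b ^ e" using Suc by (simp add: b_def e_def)
  have prod: "card (formulas m n k \<times> formulas m n k) \<le> b ^ (e + e)"
    using IH by (simp add: card_cartesian_product power_add mult_le_mono)
  have "card ?C \<le> b ^ (e + e)" "card ?D \<le> b ^ (e + e)"
    by (rule le_trans[OF card_image_le prod]; simp add: finite_formulas)+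
  moreover have "card (formulas m n (Suc k)) \<le> card (leaf_formulas m n) + card ?C + card ?D"
    unfolding formulas.simps by (meson card_Un_le add_le_mono1 le_trans)
  ultimately have "card (formulas m n (Suc k)) \<le> (4 * m * n + 2) + 2 * b ^ (e + e)"
    using card_leaf_formulas[of m n] by linarith
  also have "\<dots> \<le> (4 * m * n + 2) * b ^ (e + e) + 2 * b ^ (e + e)"
  proof -
    have "1 \<le> b ^ (e + e)" by (simp add: b_def)
    from mult_le_mono2[OF this, of "4 * m * n + 2"] show ?thesis by simp
  qed
  also have "\<dots> = b ^ Suc (e + e)" by (simp add: b_def algebra_simps)
  finally show ?case using e by (simp add: b_def)
qed

lemma protocol_formula_in_formulas:
  assumes "\<forall>X\<in>A. \<forall>Y\<in>B. strongly_differ m n h X Y (run P X Y)" "depth P \<le> k"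
  shows "protocol_formula P g A B \<in> formulas m n k"
  using assms
proof (induction P arbitrary: A B k)
  case (Output z)
  have leaf: "leaf_formulas m n \<subseteq> formulas m n k" by (cases k) auto
  have "protocol_formula (Output z) g A B \<in> leaf_formulas m n"
  proof (cases "A = {} \<or> B = {}")
    case False
    then have "fst z < m" "snd z < n"
      using Output.prems(1) by (auto simp: strongly_differ_def)
    with False show ?thesis by (auto simp: leaf_formulas_def Let_def image_iff)
  qed (auto simp: leaf_formulas_def)
  with leaf show ?case by blast
next
  case (Alice p P Q)
  then obtain k' where k: "k = Suc k'" by (cases k) auto
  have "protocol_formula P g {X \<in> A. p X} B \<in> formulas m n k'"
    by (rule Alice.IH(1)) (use Alice.prems k in auto)
  moreover have "protocol_formula Q g {X \<in> A. \<not> p X} B \<in> formulas m n k'"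
    by (rule Alice.IH(2)) (use Alice.prems k in auto)
  ultimately show ?case by (auto simp: k)
next
  case (Bob p P Q)
  then obtain k' where k: "k = Suc k'" by (cases k) auto
  have "protocol_formula P g A {Y \<in> B. p Y} \<in> formulas m n k'"
    by (rule Bob.IH(1)) (use Bob.prems k in fastforce)+
  moreover have "protocol_formula Q g A {Y \<in> B. \<not> p Y} \<in> formulas m n k'"
    by (rule Bob.IH(2)) (use Bob.prems k in fastforce)+
  ultimately show ?case by (auto simp: k)
qed

section \<open>Matrices with given column vector\<close>

lemma finite_lists_over:
  assumes "\<forall>A\<in>set As. finite A"
  shows "finite {xs. list_all2 (\<in>) xs As}"
proof (rule finite_subset)
  show "{xs. list_all2 (\<in>) xs As} \<subseteq> {xs. set xs \<subseteq> \<Union> (set As) \<and> length xs = length As}"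
    by (fastforce simp: list_all2_conv_all_nth in_set_conv_nth)
  show "finite {xs. set xs \<subseteq> \<Union> (set As) \<and> length xs = length As}"
    using assms by (intro finite_lists_length_eq) auto
qed

lemma card_lists_over:
  assumes "\<forall>A\<in>set As. finite A \<and> card A = q"
  shows "card {xs. list_all2 (\<in>) xs As} = q ^ length As"
  using assms
proof (induction As)
  case (Cons A As)
  have "card {xs. list_all2 (\<in>) xs (A # As)} =
      (\<Sum>x\<in>A. card {xs. x # xs \<in> {xs. list_all2 (\<in>) xs (A # As)}})"
    by (rule card_lists_split) (use Cons.prems finite_lists_over[of "A # As"] in auto)
  also have "\<dots> = (\<Sum>x\<in>A. q ^ length As)"
    by (rule sum.cong) (use Cons in auto)
  finally show ?case using Cons.prems by simp
qed simp

definition rows_over :: "nat \<Rightarrow> (bool list \<Rightarrow> bool) \<Rightarrow> bool list \<Rightarrow> bool list set list" where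
  "rows_over n g a = map (\<lambda>c. {x \<in> cube n. g x = c}) a"

text \<open>Encoded as a product of row sets, the shape that the lemmas on \<open>thick\<close>
  require; \<open>fibre_iff\<close> recovers the reading as matrices with column vector
  \<open>a\<close>.\<close>

definition fibre :: "nat \<Rightarrow> (bool list \<Rightarrow> bool) \<Rightarrow> bool list \<Rightarrow> bool list list set" where
  "fibre n g a = {X. list_all2 (\<in>) X (rows_over n g a)}"

lemma length_rows_over [simp]: "length (rows_over n g a) = length a"
  by (simp add: rows_over_def)

lemma finite_rows_over: "\<forall>A\<in>set (rows_over n g a). finite A"
  using finite_cube by (auto simp: rows_over_def)

lemma finite_fibre: "finite (fibre n g a)"
  unfolding fibre_def by (rule finite_lists_over[OF finite_rows_over])

lemma fibre_iff:
  "X \<in> fibre n g a \<longleftrightarrow> X \<in> bool_matrices (length a) n \<and> rowwise g X = a"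
proof
  assume *: "X \<in> fibre n g a"
  then have len: "length X = length a" "\<forall>i<length a. X ! i \<in> cube n \<and> g (X ! i) = a ! i"
    by (auto simp: fibre_def rows_over_def list_all2_conv_all_nth)
  then have "rowwise g X = a" by (auto simp: rowwise_def intro: nth_equalityI)
  moreover have "X \<in> bool_matrices (length a) n"
    using len by (auto simp: bool_matrices_def in_set_conv_nth)
  ultimately show "X \<in> bool_matrices (length a) n \<and> rowwise g X = a" by blast
next
  assume *: "X \<in> bool_matrices (length a) n \<and> rowwise g X = a"
  then have "length X = length a" "\<forall>i<length a. X ! i \<in> cube n \<and> g (X ! i) = a ! i"
    by (auto simp: bool_matrices_def rowwise_def)
  then show "X \<in> fibre n g a"
    by (auto simp: fibre_def rows_over_def list_all2_conv_all_nth)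
qed

lemma fibre_nonempty:
  assumes "nonconstant n g"
  shows "fibre n g a \<noteq> {}"
proof -
  have "\<exists>x. x \<in> cube n \<and> g x = c" for c
    using assms unfolding nonconstant_def by (cases c) metis+
  then obtain x where "\<And>c. x c \<in> cube n \<and> g (x c) = c" by metis
  then have "map x a \<in> fibre n g a"
    by (auto simp: fibre_def rows_over_def list_all2_conv_all_nth)
  then show ?thesis by blast
qed

lemma finite_bool_matrices: "finite (bool_matrices m n)"
proof (rule finite_subset)
  show "bool_matrices m n \<subseteq> {X. set X \<subseteq> cube n \<and> length X = m}" by (auto simp: bool_matrices_def)
  show "finite {X. set X \<subseteq> cube n \<and> length X = m}"
    by (rule finite_lists_length_eq[OF finite_cube(1)])
qed

lemma strong_comp_solvable: "\<exists>P. solves P (strong_comp_KW m n f g)"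
proof (rule solvable)
  show "finite (alice_inputs (strong_comp_KW m n f g))" "finite (bob_inputs (strong_comp_KW m n f g))"
    using finite_bool_matrices by (simp_all add: strong_comp_KW_def)
  fix X Y
  assume "X \<in> alice_inputs (strong_comp_KW m n f g)" "Y \<in> bob_inputs (strong_comp_KW m n f g)"
  then have XY: "X \<in> bool_matrices m n" "Y \<in> bool_matrices m n" "rowwise g X \<noteq> rowwise g Y"
    by (auto simp: strong_comp_KW_def block_comp_def)
  then have "length (rowwise g X) = m" "length (rowwise g Y) = m"
    by (auto simp: bool_matrices_def rowwise_def)
  with XY(3) obtain i where i: "i < m" "rowwise g X ! i \<noteq> rowwise g Y ! i"
    using list_eq_iff_nth_eq[of "rowwise g X" "rowwise g Y"] by auto
  then have "X ! i \<noteq> Y ! i" "length (X ! i) = n" "length (Y ! i) = n"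
    using XY by (auto simp: bool_matrices_def rowwise_def cube_def subset_iff)
  then obtain j where "j < n" "X ! i ! j \<noteq> Y ! i ! j"
    using list_eq_iff_nth_eq[of "X ! i" "Y ! i"] by auto
  with i show "\<exists>z. correct (strong_comp_KW m n f g) X Y z"
    by (intro exI[of _ "(i, j)"]) (simp add: strong_comp_KW_def)
qed

lemma strong_comp_correct:
  assumes "solves P (strong_comp_KW m n f g)" "a \<in> cube m" "b \<in> cube m" "f a" "\<not> f b"
    "X \<in> fibre n g a" "Y \<in> fibre n g b"
  shows "strongly_differ m n g X Y (run P X Y)"
proof -
  have len: "length a = m" "length b = m" using assms by (auto simp: cube_def)
  have XY: "X \<in> bool_matrices m n" "Y \<in> bool_matrices m n" "rowwise g X = a" "rowwise g Y = b"
    using assms len by (auto simp: fibre_iff)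
  then have "X \<in> alice_inputs (strong_comp_KW m n f g)" "Y \<in> bob_inputs (strong_comp_KW m n f g)"
    using assms by (auto simp: strong_comp_KW_def block_comp_def)
  with assms(1) have "correct (strong_comp_KW m n f g) X Y (run P X Y)"
    by (auto simp: solves_def)
  moreover have "length X = m" "length Y = m" using XY by (auto simp: bool_matrices_def)
  ultimately show ?thesis
    by (auto simp: strongly_differ_def strong_comp_KW_def rowwise_def case_prod_beta)
qed

lemma disjoint_rect_preimages: "disjoint_rect m {x \<in> cube m. f x} {y \<in> cube m. \<not> f y}"
  by (auto simp: disjoint_rect_def)

text \<open>After a walk of full depth the output row is fixed and solves what is left of
  \<open>KW m f\<close>, while the nonempty fibres guarantee surviving matrices. This settles the
  range \<open>n = O(log (m n))\<close>, where \<open>n\<close> disappears in the error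
  term.\<close>

lemma protocol_size_KW_le_depth:
  assumes "nonconstant n g" "solves P (strong_comp_KW m n f g)"
  shows "protocol_size (KW m f) \<le> 2 ^ depth P"
proof -
  let ?A = "{x \<in> cube m. f x}" and ?B = "{y \<in> cube m. \<not> f y}"
  have "\<exists>Q A' B' S T tA tB. walked m (depth P) P ?A ?B (fibre n g) (fibre n g) Q A' B' S T tA tB"
    by (rule walk[OF disjoint_rect_preimages]) (simp_all add: finite_fibre)
  then obtain Q A' B' S T tA tB where
    w: "walked m (depth P) P ?A ?B (fibre n g) (fibre n g) Q A' B' S T tA tB"
    by blast
  then have "depth Q = 0" by (simp add: walked_def)
  then obtain z where Q: "Q = Output z" by (cases Q) auto
  have "card (fibre n g a) > 0" for a
    using fibre_nonempty[OF assms(1)] finite_fibre by (simp add: card_gt_0_iff)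
  note fibre_pos = this
  have ne: "S a \<noteq> {}" if "a \<in> A'" for a
  proof
    assume "S a = {}"
    moreover have "card (fibre n g a) \<le> 2 ^ tA * card (S a)" using w that unfolding walked_def by blast
    ultimately show False using fibre_pos[of a] by simp
  qed
  have ne': "T b \<noteq> {}" if "b \<in> B'" for b
  proof
    assume "T b = {}"
    moreover have "card (fibre n g b) \<le> 2 ^ tB * card (T b)" using w that unfolding walked_def by blast
    ultimately show False using fibre_pos[of b] by simp
  qed
  have "rect_size m A' B' \<le> 1"
  proof (rule rect_size_constant_answer[where i = "fst z"], intro ballI)
    fix a b assume ab: "a \<in> A'" "b \<in> B'"
    then obtain X Y where X: "X \<in> S a" and Y: "Y \<in> T b" using ne ne' by blast
    have mem: "a \<in> ?A" "b \<in> ?B" "X \<in> fibre n g a" "Y \<in> fibre n g b" "run P X Y = z"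
      using w ab X Y Q unfolding walked_def by fastforce+
    then have "strongly_differ m n g X Y z"
      using strong_comp_correct[OF assms(2), of a b X Y] by simp
    moreover have "rowwise g X = a" "rowwise g Y = b" "length X = m" "length Y = m"
      using mem by (auto simp: fibre_iff cube_def bool_matrices_def)
    ultimately show "fst z < m \<and> a ! fst z \<noteq> b ! fst z"
      by (auto simp: strongly_differ_def rowwise_def)
  qed
  moreover have "rect_size m ?A ?B \<le> 2 ^ depth P * rect_size m A' B'"
    using w by (simp add: walked_def)
  ultimately have "rect_size m ?A ?B \<le> 2 ^ depth P * 1"
    by (meson le_trans mult_le_mono2)
  then show ?thesis by (simp add: KW_eq_KW_on)
qed

section \<open>Thick sets for agreeing column vectors\<close>

text \<open>Chernoff bound: on the event the indicator is at most
  \<open>r ^ (trues ks - trues us / c)\<close>, as \<open>r < 1\<close>, and the expectation of this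
  weight factorises.\<close>

lemma few_trues_tail:
  assumes "0 \<le> p" "p \<le> 1" "0 < r" "r < 1" "c > 0"
  shows "avg p us (\<lambda>ks. of_bool (c * trues ks < trues us)) \<le>
    ((1 / r) powr (1 / real c) * (1 - p + p * r)) ^ trues us"
proof -
  let ?u = "trues us"
  have "avg p us (\<lambda>ks. of_bool (c * trues ks < ?u)) \<le>
      avg p us (\<lambda>ks. (1 / r) powr (real ?u / real c) * r ^ trues ks)"
  proof (intro avg_mono assms(1,2))
    fix ks
    show "of_bool (c * trues ks < ?u) \<le> (1 / r) powr (real ?u / real c) * r ^ trues ks"
    proof (cases "c * trues ks < ?u")
      case True
      have "real (c * trues ks) \<le> real ?u" using True by linarith
      then have "real (trues ks) \<le> real ?u / real c"
        using \<open>c > 0\<close> by (simp add: field_simps)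
      then have "(1 / r) powr real (trues ks) \<le> (1 / r) powr (real ?u / real c)"
        using assms by (intro powr_mono) auto
      then have "(1 / r) ^ trues ks \<le> (1 / r) powr (real ?u / real c)"
        using assms by (simp add: powr_realpow)
      then have "(1 / r) ^ trues ks * r ^ trues ks \<le> (1 / r) powr (real ?u / real c) * r ^ trues ks"
        using assms by (intro mult_right_mono) auto
      moreover have "(1 / r) ^ trues ks * r ^ trues ks = 1"
        using assms by (simp add: power_mult_distrib[symmetric])
      ultimately show ?thesis using True by simp
    qed (use assms in auto)
  qed
  also have "\<dots> = (1 / r) powr (real ?u / real c) * (1 - p + p * r) ^ ?u"
    by (simp add: avg_cmult avg_power_trues)
  also have "(1 / r) powr (real ?u / real c) = ((1 / r) powr (1 / real c)) ^ ?u"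
    using assms by (simp add: powr_realpow[symmetric] powr_powr)
  finally show ?thesis by (simp add: power_mult_distrib)
qed

text \<open>Here \<open>r = 1 / 2\<close> is close to the optimal tilt for \<open>c = 3\<close>; the
  18th power clears the fractional exponents.\<close>

lemma base_one_third: "(1 / (1 / 2)) powr (1 / real 3) * (1 - 49 / 100 + 49 / 100 * (1 / 2)) \<le> 2 powr (- (1 / 18))"
proof -
  have "((2::real) powr (1 / 3)) ^ 18 = 2 powr (1 / 3 * 18)"
    by (simp add: powr_realpow[symmetric] powr_powr)
  then have "((2::real) powr (1 / 3)) ^ 18 = 64" by simp
  moreover have "((2::real) powr (- (1 / 18))) ^ 18 = 2 powr (- (1 / 18) * 18)"
    by (simp add: powr_realpow[symmetric] powr_powr)
  then have "((2::real) powr (- (1 / 18))) ^ 18 = 1 / 2" by (simp add: powr_minus)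
  ultimately have "((2::real) powr (1 / 3) * (151 / 200)) ^ 18 \<le> (2 powr (- (1 / 18))) ^ 18"
    by (simp add: power_mult_distrib power_divide)
  then have "(2::real) powr (1 / 3) * (151 / 200) \<le> 2 powr (- (1 / 18))"
    by (subst (asm) power_mono_iff) auto
  then show ?thesis by simp
qed

text \<open>Here \<open>r = 1 / 3\<close> is close to optimal for \<open>c = 4\<close>. The rate
  \<open>1 / 6\<close> on at least \<open>m / 3\<close> flags again yields
  \<open>m / 18\<close>.\<close>

lemma base_one_quarter: "(1 / (1 / 3)) powr (1 / real 4) * (1 - 49 / 100 + 49 / 100 * (1 / 3)) \<le> 2 powr (- (1 / 6))"
proof -
  have "((3::real) powr (1 / 4)) ^ 12 = 3 powr (1 / 4 * 12)"
    by (simp add: powr_realpow[symmetric] powr_powr)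
  then have "((3::real) powr (1 / 4)) ^ 12 = 27" by simp
  moreover have "((2::real) powr (- (1 / 6))) ^ 12 = 2 powr (- (1 / 6) * 12)"
    by (simp add: powr_realpow[symmetric] powr_powr)
  then have "((2::real) powr (- (1 / 6))) ^ 12 = 1 / 4" by (simp add: powr_minus)
  ultimately have "((3::real) powr (1 / 4) * (101 / 150)) ^ 12 \<le> (2 powr (- (1 / 6))) ^ 12"
    by (simp add: power_mult_distrib power_divide)
  then have "(3::real) powr (1 / 4) * (101 / 150) \<le> 2 powr (- (1 / 6))"
    by (subst (asm) power_mono_iff) auto
  then show ?thesis by simp
qed

text \<open>The tail beats the density as soon as \<open>m / 18 - m / 24 = m / 72\<close> is at
  least 1.\<close>

lemma half_power_bound:
  assumes "24 * t \<le> m" "100 \<le> m"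
  shows "2 powr (- (real m / 18)) \<le> (1 / 2) ^ (t + 1)"
proof -
  have "real t + 1 \<le> real m / 18" using assms by linarith
  then have "2 powr (- (real m / 18)) \<le> 2 powr (- real (t + 1))" by (intro powr_mono) auto
  also have "\<dots> = (1 / 2) ^ (t + 1)"
    by (subst powr_minus) (simp add: powr_realpow power_divide inverse_eq_divide powr_add)
  finally show ?thesis .
qed

lemma card_not_true:
  "card {i. i < length ks \<and> \<not> ks ! i} + trues ks = length ks"
proof -
  have "trues ks = card {i. i < length ks \<and> ks ! i}"
    by (simp add: count_list_eq_length_filter length_filter_conv_card eq_commute)
  moreover have "card {i. i < length ks \<and> \<not> ks ! i} + card {i. i < length ks \<and> ks ! i} = card {..<length ks}"
    by (subst card_Un_disjoint[symmetric]) (auto intro!: arg_cong[where f=card] simp del: card_lessThan)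
  ultimately show ?thesis by simp
qed

text \<open>\<open>thick_card\<close> gives probability at least \<open>2 ^ -t\<close> for
  thickness; removing the tail, at most half of that, leaves the other half.\<close>

lemma many_good_flags:
  assumes "c > 0" "S \<subseteq> {xs. list_all2 (\<in>) xs As}" "\<forall>A\<in>set As. finite A \<and> card A = q" "q > 0"
    "length As = length us" "s > 0" "real s - 1 \<le> 51 / 100 * real q"
    "q ^ length us \<le> 2 ^ t * card S"
    "avg (49 / 100) us (\<lambda>ks. of_bool (c * trues ks < trues us)) \<le> (1 / 2) ^ (t + 1)"
  shows "(1 / 2) ^ (t + 1) \<le>
    avg (49 / 100) us (\<lambda>ks. of_bool (thick s ks S \<and> trues us \<le> c * trues ks))"
proof -
  have fin: "finite S" using assms finite_lists_over finite_subset by metis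
  have "real (card S) \<le> real q ^ length us * avg (49 / 100) us (\<lambda>ks. of_bool (thick s ks S))"
    by (rule thick_card[where As = As]) (use assms fin in auto)
  moreover have "real q ^ length us \<le> 2 ^ t * real (card S)"
    using of_nat_mono[OF assms(8), where 'a = real] by simp
  ultimately have "real q ^ length us \<le>
      2 ^ t * (real q ^ length us * avg (49 / 100) us (\<lambda>ks. of_bool (thick s ks S)))"
    by (meson mult_left_mono order_trans zero_le_numeral zero_le_power)
  then have "real q ^ length us * 1 \<le>
      real q ^ length us * (2 ^ t * avg (49 / 100) us (\<lambda>ks. of_bool (thick s ks S)))"
    by (simp add: mult_ac)
  then have "1 \<le> 2 ^ t * avg (49 / 100) us (\<lambda>ks. of_bool (thick s ks S))"
    using \<open>q > 0\<close> by simp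
  then have 1: "(1 / 2) ^ t \<le> avg (49 / 100) us (\<lambda>ks. of_bool (thick s ks S))"
    by (simp add: power_divide field_simps)
  have "avg (49 / 100) us (\<lambda>ks. of_bool (thick s ks S)) \<le>
    avg (49 / 100) us (\<lambda>ks. of_bool (thick s ks S \<and> trues us \<le> c * trues ks) +
      of_bool (c * trues ks < trues us))"
    by (rule avg_mono) auto
  with 1 assms(9) show ?thesis by (simp add: avg_add)
qed

text \<open>Alice announces \<open>vs\<close>; Bob then thins out \<open>vs\<close> itself, so that
  the final \<open>ks\<close> suits both. The two announcements cost
  \<open>16 * m^2 * 2 ^ (tA + tB)\<close> in rectangle size, and what remains is too hard for all
  pairs to differ outside \<open>ks\<close>.\<close>

lemma find_flags:
  fixes S :: "bool list \<Rightarrow> 'x list set" and T :: "bool list \<Rightarrow> 'x list set"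
  assumes rect: "disjoint_rect m A B" and m: "100 \<le> m" and t: "tA + tB \<le> t" "24 * t \<le> m"
    and As: "\<forall>a\<in>A. S a \<subseteq> {xs. list_all2 (\<in>) xs (As a)} \<and> length (As a) = m \<and>
      (\<forall>R\<in>set (As a). finite R \<and> card R = q) \<and> q ^ m \<le> 2 ^ tA * card (S a)"
    and Bs: "\<forall>b\<in>B. T b \<subseteq> {xs. list_all2 (\<in>) xs (Bs b)} \<and> length (Bs b) = m \<and>
      (\<forall>R\<in>set (Bs b). finite R \<and> card R = q) \<and> q ^ m \<le> 2 ^ tB * card (T b)"
    and s: "s > 0" "real s - 1 \<le> 51 / 100 * real q" "q > 0"
    and size: "48 * real m ^ 2 * 2 powr (11 / 12 * m) * 2 ^ t < rect_size m A B"
  shows "\<exists>ks a b. length ks = m \<and> a \<in> A \<and> b \<in> B \<and> thick s ks (S a) \<and> thick s ks (T b) \<and>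
    (\<forall>i<m. \<not> ks ! i \<longrightarrow> a ! i = b ! i)"
proof -
  let ?us = "replicate m True"
  have us: "trues ?us = m" by (induction m) auto
  have tAB: "24 * tA \<le> m" "24 * tB \<le> m" using t by linarith+
  define goodA where "goodA a ks \<longleftrightarrow> thick s ks (S a) \<and> m \<le> 3 * trues ks" for a ks
  have tail1: "avg (49 / 100) ?us (\<lambda>ks. of_bool (3 * trues ks < trues ?us)) \<le> (1 / 2) ^ (tA + 1)"
  proof -
    have "avg (49 / 100) ?us (\<lambda>ks. of_bool (3 * trues ks < trues ?us)) \<le>
      ((1 / (1 / 2)) powr (1 / real 3) * (1 - 49 / 100 + 49 / 100 * (1 / 2))) ^ trues ?us"
      by (rule few_trues_tail) auto
    also have "\<dots> \<le> (2 powr (- (1 / 18))) ^ m"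
      unfolding us by (intro power_mono base_one_third) auto
    also have "\<dots> = 2 powr (- (real m / 18))" by (simp add: powr_realpow[symmetric] powr_powr)
    finally show ?thesis using half_power_bound[OF tAB(1) m] by linarith
  qed
  have "\<forall>a\<in>A. (1 / 2) ^ (tA + 1) \<le> avg (49 / 100) ?us (\<lambda>ks. of_bool (goodA a ks))"
  proof
    fix a assume "a \<in> A"
    with As have "(1 / 2) ^ (tA + 1) \<le>
        avg (49 / 100) ?us (\<lambda>ks. of_bool (thick s ks (S a) \<and> trues ?us \<le> 3 * trues ks))"
      by (intro many_good_flags[where As = "As a" and q = q] s tail1) auto
    then show "(1 / 2) ^ (tA + 1) \<le> avg (49 / 100) ?us (\<lambda>ks. of_bool (goodA a ks))"
      by (simp only: us goodA_def)
  qed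
  then have "\<exists>vs. subflags vs ?us \<and>
    real (rect_size m A B) \<le> 2 * real m / (1 / 2) ^ (tA + 1) * real (rect_size m {a \<in> A. goodA a vs} B)"
    using m by (intro announce_flags[OF rect, where p = "49 / 100"] power_le_one) simp_all
  then obtain vs where vs: "subflags vs ?us"
    "real (rect_size m A B) \<le> 2 * real m / (1 / 2) ^ (tA + 1) * real (rect_size m {a \<in> A. goodA a vs} B)"
    by blast
  define A1 where "A1 = {a \<in> A. goodA a vs}"
  have lenvs: "length vs = m" using list_all2_lengthD[OF vs(1)] by simp
  have rect1: "disjoint_rect m A1 B" by (rule disjoint_rect_subset[OF rect]) (auto simp: A1_def)
  have L1: "real (rect_size m A B) \<le> 4 * real m * 2 ^ tA * real (rect_size m A1 B)"
    using vs(2) by (simp add: A1_def power_divide field_simps)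
  have big: "48 * real m ^ 2 * 2 ^ t < rect_size m A B"
  proof -
    have "48 * real m ^ 2 * 1 * 2 ^ t \<le> 48 * real m ^ 2 * 2 powr (11 / 12 * m) * 2 ^ t"
      by (intro mult_right_mono mult_left_mono ge_one_powr_ge_zero) auto
    with size show ?thesis by simp
  qed
  have two: "2 ^ tA \<le> (2::real) ^ t" "2 ^ (tA + tB) \<le> (2::real) ^ t" using t by (auto intro: power_increasing)
  \<comment> \<open>The count of \<open>vs\<close> is part of \<open>goodA\<close>, so it can be
    read off only from an actual member of \<open>A1\<close>; likewise for \<open>B1\<close>
    below.\<close>
  have A1: "A1 \<noteq> {}"
  proof
    assume "A1 = {}"
    then have "rect_size m A1 B \<le> 1" by (intro rect_size_constant_answer[of _ _ 0]) auto
    then have "4 * real m * 2 ^ tA * real (rect_size m A1 B) \<le> 4 * real m * 2 ^ t * 1"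
      using two by (intro mult_mono) auto
    also have "\<dots> \<le> 48 * real m ^ 2 * 2 ^ t"
    proof -
      have "real m \<le> real m ^ 2" using m by (intro self_le_power) auto
      then have "4 * real m \<le> 48 * real m ^ 2" by linarith
      then have "4 * real m * 2 ^ t \<le> 48 * real m ^ 2 * 2 ^ t" by (intro mult_right_mono) auto
      then show ?thesis by simp
    qed
    finally show False using L1 big by linarith
  qed
  then have u: "m \<le> 3 * trues vs" by (auto simp: A1_def goodA_def)
  define goodB where "goodB b ks \<longleftrightarrow> thick s ks (T b) \<and> trues vs \<le> 4 * trues ks" for b ks
  have tail2: "avg (49 / 100) vs (\<lambda>ks. of_bool (4 * trues ks < trues vs)) \<le> (1 / 2) ^ (tB + 1)"
  proof -
    have "avg (49 / 100) vs (\<lambda>ks. of_bool (4 * trues ks < trues vs)) \<le>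
      ((1 / (1 / 3)) powr (1 / real 4) * (1 - 49 / 100 + 49 / 100 * (1 / 3))) ^ trues vs"
      by (rule few_trues_tail) auto
    also have "\<dots> \<le> (2 powr (- (1 / 6))) ^ trues vs"
      by (intro power_mono base_one_quarter) auto
    also have "\<dots> = 2 powr (- (real (trues vs) / 6))" by (simp add: powr_realpow[symmetric] powr_powr)
    also have "\<dots> \<le> 2 powr (- (real m / 18))"
      using u by (intro powr_mono) auto
    finally show ?thesis using half_power_bound[OF tAB(2) m] by linarith
  qed
  have "\<forall>b\<in>B. (1 / 2) ^ (tB + 1) \<le> avg (49 / 100) vs (\<lambda>ks. of_bool (goodB b ks))"
  proof
    fix b assume "b \<in> B"
    with Bs show "(1 / 2) ^ (tB + 1) \<le> avg (49 / 100) vs (\<lambda>ks. of_bool (goodB b ks))"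
      unfolding goodB_def
      by (intro many_good_flags[where As = "Bs b" and q = q] s tail2) (auto simp: lenvs)
  qed
  then have "\<exists>ks. subflags ks vs \<and>
    real (rect_size m B A1) \<le> 2 * real m / (1 / 2) ^ (tB + 1) * real (rect_size m {b \<in> B. goodB b ks} A1)"
    using m by (intro announce_flags[OF disjoint_rect_swap[OF rect1], where p = "49 / 100"] power_le_one)
      simp_all
  then obtain ks where ks: "subflags ks vs"
    "real (rect_size m B A1) \<le> 2 * real m / (1 / 2) ^ (tB + 1) * real (rect_size m {b \<in> B. goodB b ks} A1)"
    by blast
  define B1 where "B1 = {b \<in> B. goodB b ks}"
  have lenks: "length ks = m" using list_all2_lengthD[OF ks(1)] lenvs by simp
  have rect2: "disjoint_rect m A1 B1" by (rule disjoint_rect_subset[OF rect1]) (auto simp: B1_def)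
  have "real (rect_size m B A1) \<le> 4 * real m * 2 ^ tB * real (rect_size m B1 A1)"
    using ks(2) by (simp add: B1_def power_divide field_simps)
  then have "real (rect_size m A1 B) \<le> 4 * real m * 2 ^ tB * real (rect_size m A1 B1)"
    by (simp add: rect_size_swap[OF rect1] rect_size_swap[OF rect2])
  then have "4 * real m * 2 ^ tA * real (rect_size m A1 B) \<le> 4 * real m * 2 ^ tA * (4 * real m * 2 ^ tB * real (rect_size m A1 B1))"
    by (intro mult_left_mono) auto
  with L1 have "real (rect_size m A B) \<le> 16 * real m ^ 2 * 2 ^ (tA + tB) * real (rect_size m A1 B1)"
    by (simp add: power_add power2_eq_square mult_ac)
  also have "\<dots> \<le> 16 * real m ^ 2 * 2 ^ t * real (rect_size m A1 B1)"
    using two by (intro mult_right_mono mult_left_mono) auto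
  finally have L2: "real (rect_size m A B) \<le> 16 * real m ^ 2 * 2 ^ t * real (rect_size m A1 B1)" .
  have B1: "B1 \<noteq> {}"
  proof
    assume "B1 = {}"
    then have "rect_size m A1 B1 \<le> 1" by (intro rect_size_constant_answer[of _ _ 0]) auto
    then have "16 * real m ^ 2 * 2 ^ t * real (rect_size m A1 B1) \<le> 16 * real m ^ 2 * 2 ^ t * 1"
      by (intro mult_left_mono) auto
    also have "\<dots> \<le> 48 * real m ^ 2 * 2 ^ t" by simp
    finally show False using L2 big by linarith
  qed
  then have u2: "m \<le> 12 * trues ks" using u by (auto simp: B1_def goodB_def)
  define I where "I = {i. i < m \<and> \<not> ks ! i}"
  have "card I + trues ks = m" using card_not_true[of ks] lenks by (simp add: I_def)
  with u2 have cardI: "12 * card I \<le> 11 * m" by linarith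
  have "\<exists>a\<in>A1. \<exists>b\<in>B1. \<forall>i\<in>I. a ! i = b ! i"
  proof (rule ccontr)
    assume neg: "\<not> ?thesis"
    have "rect_size m A1 B1 + 2 \<le> 3 * 2 ^ card I"
      by (rule rect_size_differ_within[OF _ _ rect2]) (use neg in \<open>auto simp: I_def\<close>)
    then have "real (rect_size m A1 B1) \<le> real (3 * 2 ^ card I)" by linarith
    also have "\<dots> = 3 * 2 powr card I" by (simp add: powr_realpow)
    also have "\<dots> \<le> 3 * 2 powr (11 / 12 * m)" using cardI by (intro mult_left_mono powr_mono) auto
    finally have "16 * real m ^ 2 * 2 ^ t * real (rect_size m A1 B1) \<le>
        16 * real m ^ 2 * 2 ^ t * (3 * 2 powr (11 / 12 * m))"
      by (intro mult_left_mono) auto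
    also have "\<dots> = 48 * real m ^ 2 * 2 powr (11 / 12 * m) * 2 ^ t" by simp
    finally show False using L2 size by linarith
  qed
  then obtain a b where ab: "a \<in> A1" "b \<in> B1" "\<forall>i\<in>I. a ! i = b ! i" by blast
  have a: "a \<in> A" "thick s vs (S a)" using ab by (auto simp: A1_def goodA_def)
  then have "thick s ks (S a)"
    using As by (intro thick_subflags[OF a(2) ks(1) s(1), where As = "As a"]) (auto simp: lenvs)
  moreover have "b \<in> B" "thick s ks (T b)" using ab by (auto simp: B1_def goodB_def)
  ultimately show ?thesis using ab a lenks by (auto simp: I_def)
qed

section \<open>The lower bound\<close>

lemma large_class:
  assumes "finite X" "finite Y" "col ` X \<subseteq> Y"
    "real (card Y) * B < real (card X)" "0 \<le> B"
  shows "\<exists>c\<in>Y. B < real (card {x \<in> X. col x = c})"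
proof (rule ccontr)
  assume neg: "\<not> ?thesis"
  have "real (card X) = (\<Sum>x\<in>X. 1)" by simp
  also have "\<dots> = (\<Sum>c\<in>Y. \<Sum>x\<in>{x \<in> X. col x = c}. 1)"
    by (rule sum.group[symmetric]) (use assms in auto)
  also have "\<dots> = (\<Sum>c\<in>Y. real (card {x \<in> X. col x = c}))" by simp
  also have "\<dots> \<le> (\<Sum>c\<in>Y. B)" using neg by (intro sum_mono) (auto simp: not_less)
  also have "\<dots> = real (card Y) * B" by simp
  finally show False using assms by linarith
qed

text \<open>Two functions of one colour can be taken nearly complementary, so that the rows where
  \<open>a\<close> and \<open>b\<close> differ come from nearly the same set and can be made equal.\<close>
lemma no_cheap_family:
  assumes n: "n \<ge> 1" and s: "s > 0" "real (2 ^ (n - 1)) + real (2 ^ n) / 100 < 2 * real s"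
    and num: "real (2 ^ n) * (2 ^ (3 * m) * real (4 * m * n + 4) ^ (2 ^ (k + 1))) < exp (real (2 ^ n) / 30000)"
    and wit: "\<And>G. G \<subseteq> cube n \<Longrightarrow> card G = 2 ^ (n - 1) \<Longrightarrow>
      \<exists>P a b ks S T. depth P \<le> k \<and> a \<in> cube m \<and> b \<in> cube m \<and> ks \<in> cube m \<and>
        S \<subseteq> fibre n (\<lambda>x. x \<in> G) a \<and> T \<subseteq> fibre n (\<lambda>x. x \<in> G) b \<and> thick s ks S \<and> thick s ks T \<and>
        (\<forall>i<m. \<not> ks ! i \<longrightarrow> a ! i = b ! i) \<and>
        (\<forall>X\<in>S. \<forall>Y\<in>T. strongly_differ m n (\<lambda>x. x \<in> G) X Y (run P X Y))"
  shows False
proof -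
  define N where "N = (2::nat) ^ n"
  define q where "q = (2::nat) ^ (n - 1)"
  define Bal where "Bal = {G. G \<subseteq> cube n \<and> card G = q}"
  have Nq: "N = 2 * q" using n by (cases n) (auto simp: N_def q_def)
  have q: "q > 0" by (simp add: q_def)
  have finB: "finite Bal" using finite_cube(1)[of n] by (auto simp: Bal_def)
  have cardB: "card Bal = N choose q"
    using n_subsets[OF finite_cube(1), of n q] finite_cube(2)[of n] by (simp add: Bal_def N_def)
  define ok where "ok G w \<longleftrightarrow> (case w of (P, a, b, ks, S, T) \<Rightarrow> depth P \<le> k \<and> a \<in> cube m \<and> b \<in> cube m \<and> ks \<in> cube m \<and>
        S \<subseteq> fibre n (\<lambda>x. x \<in> G) a \<and> T \<subseteq> fibre n (\<lambda>x. x \<in> G) b \<and> thick s ks S \<and> thick s ks T \<and>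
        (\<forall>i<m. \<not> ks ! i \<longrightarrow> a ! i = b ! i) \<and>
        (\<forall>X\<in>S. \<forall>Y\<in>T. strongly_differ m n (\<lambda>x. x \<in> G) X Y (run P X Y)))" 
    for G and w :: "(bool list list, bool list list, nat \<times> nat) protocol \<times> bool list \<times> bool list \<times> bool list \<times>
      bool list list set \<times> bool list list set"
  have "\<forall>G\<in>Bal. \<exists>w. ok G w"
    using wit by (simp add: Bal_def q_def ok_def split_paired_Ex)
  from bchoice[OF this] obtain w where w': "\<forall>G\<in>Bal. ok G (w G)" by blast
  have w: "case w G of (P, a, b, ks, S, T) \<Rightarrow> depth P \<le> k \<and> a \<in> cube m \<and> b \<in> cube m \<and> ks \<in> cube m \<and>
        S \<subseteq> fibre n (\<lambda>x. x \<in> G) a \<and> T \<subseteq> fibre n (\<lambda>x. x \<in> G) b \<and> thick s ks S \<and> thick s ks T \<and>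
        (\<forall>i<m. \<not> ks ! i \<longrightarrow> a ! i = b ! i) \<and>
        (\<forall>X\<in>S. \<forall>Y\<in>T. strongly_differ m n (\<lambda>x. x \<in> G) X Y (run P X Y))" if "G \<in> Bal" for G
    using w' that by (simp add: ok_def)
  \<comment> \<open>The colour omits \<open>S\<close> and \<open>T\<close>, which have too many
    possible values; through \<open>same_formula\<close> their formula suffices. The three vectors
    cost the factor \<open>2 ^ (3 * m)\<close>.\<close>
  define col where "col G = (case w G of (P, a, b, ks, S, T) \<Rightarrow>
    (protocol_formula P (\<lambda>x. x \<in> G) S T, a, b, ks))" for G
  define Cols where "Cols = formulas m n k \<times> cube m \<times> cube m \<times> cube m"
  have finC: "finite Cols" using finite_formulas finite_cube(1) by (auto simp: Cols_def)
  have cardC: "real (card Cols) \<le> 2 ^ (3 * m) * real (4 * m * n + 4) ^ (2 ^ (k + 1))"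
  proof -
    have "card (formulas m n k) \<le> (4 * m * n + 4) ^ (2 ^ (k + 1) - 1)" by (rule card_formulas)
    also have "\<dots> \<le> (4 * m * n + 4) ^ (2 ^ (k + 1))" by (rule power_increasing) auto
    finally have "card Cols \<le> (4 * m * n + 4) ^ (2 ^ (k + 1)) * (2 ^ m * (2 ^ m * 2 ^ m))"
      by (simp add: Cols_def card_cartesian_product finite_cube)
    then have "real (card Cols) \<le> real ((4 * m * n + 4) ^ (2 ^ (k + 1)) * (2 ^ m * (2 ^ m * 2 ^ m)))"
      by (simp only: of_nat_le_iff)
    also have "\<dots> = 2 ^ (3 * m) * real (4 * m * n + 4) ^ (2 ^ (k + 1))"
    proof -
      have "3 * m = m + (m + m)" by simp
      then show ?thesis by (simp only: power_add of_nat_mult of_nat_power of_nat_numeral mult_ac)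
    qed
    finally show ?thesis .
  qed
  have colC: "col ` Bal \<subseteq> Cols"
  proof (rule image_subsetI)
    fix G assume "G \<in> Bal"
    obtain P a b ks S T where wG: "w G = (P, a, b, ks, S, T)" by (cases "w G") auto
    show "col G \<in> Cols"
      using w[OF \<open>G \<in> Bal\<close>] wG by (auto simp: col_def Cols_def intro: protocol_formula_in_formulas)
  qed
  \<comment> \<open>This is the threshold of \<open>nearly_complementary_pair\<close> for
    \<open>e = 1 / 100\<close>, as \<open>e^2 / 3 = 1 / 30000\<close>.\<close>
  define D where "D = 2 ^ N * exp (- (real N / 30000))"
  have "real (card Cols) * D < real (card Bal)"
  proof -
    have N: "real N > 0" by (simp add: N_def)
    have "real N * real (card Cols) \<le> real N * (2 ^ (3 * m) * real (4 * m * n + 4) ^ (2 ^ (k + 1)))"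
      using cardC by (intro mult_left_mono) auto
    also have "\<dots> < exp (real N / 30000)" using num by (simp add: N_def)
    finally have "real N * real (card Cols) * D < exp (real N / 30000) * D"
      by (intro mult_strict_right_mono) (auto simp: D_def)
    also have "exp (real N / 30000) * D = 2 ^ N"
      by (simp add: D_def exp_minus)
    finally have "real (card Cols) * D < 2 ^ N / real N" using N by (simp add: field_simps)
    \<comment> \<open>Balanced functions are a fraction at least \<open>1 / N\<close> of all
      functions; this is the extra factor \<open>2 ^ n\<close> in the hypothesis
      \<open>num\<close>.\<close>
    also have "(2::real) ^ N / real N = 4 ^ q / (2 * real q)"
      by (simp add: Nq power_mult)
    also have "\<dots> \<le> real ((2 * q) choose q)"
      using central_binomial_lower_bound[OF q] by simp
    finally show ?thesis by (simp add: cardB Nq)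
  qed
  then obtain c where c: "c \<in> Cols" "D < real (card {G \<in> Bal. col G = c})"
    using large_class[OF finB finC colC, of D] by (auto simp: D_def)
  define F where "F = {G \<in> Bal. col G = c}"
  have "\<exists>G\<in>F. \<exists>H\<in>F. card {v \<in> cube n. v \<in> G \<longleftrightarrow> v \<in> H} \<le> 1 / 100 * real (card (cube n))"
    using c(2) by (intro nearly_complementary_pair finite_cube)
      (auto simp: F_def Bal_def D_def finite_cube(2) N_def power2_eq_square)
  then obtain G H where GH: "G \<in> F" "H \<in> F"
    "card {v \<in> cube n. v \<in> G \<longleftrightarrow> v \<in> H} \<le> real N / 100"
    by (auto simp: finite_cube(2) N_def)
  have Bal: "G \<in> Bal" "H \<in> Bal" "col G = col H" using GH by (auto simp: F_def)
  obtain P a b ks S T where wG: "w G = (P, a, b, ks, S, T)" by (cases "w G") auto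
  obtain P' a' b' ks' S' T' where wH: "w H = (P', a', b', ks', S', T')" by (cases "w H") auto
  have eq: "a' = a" "b' = b" "ks' = ks"
    "protocol_formula P (\<lambda>x. x \<in> G) S T = protocol_formula P' (\<lambda>x. x \<in> H) S' T'"
    using Bal(3) wG wH by (auto simp: col_def)
  have G: "length a = m" "length b = m" "length ks = m" "S \<subseteq> fibre n (\<lambda>x. x \<in> G) a" "thick s ks S"
    "\<forall>i<m. \<not> ks ! i \<longrightarrow> a ! i = b ! i"
    "\<forall>X\<in>S. \<forall>Y\<in>T. strongly_differ m n (\<lambda>x. x \<in> G) X Y (run P X Y)"
    using w[OF Bal(1)] wG by (auto simp: cube_def)
  have H: "T' \<subseteq> fibre n (\<lambda>x. x \<in> H) b" "thick s ks T'"
    "\<forall>X\<in>S'. \<forall>Y\<in>T'. strongly_differ m n (\<lambda>x. x \<in> H) X Y (run P' X Y)"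
    using w[OF Bal(2)] wH eq by auto
  let ?As = "rows_over n (\<lambda>x. x \<in> G) a" and ?Bs = "rows_over n (\<lambda>x. x \<in> H) b"
  obtain X Y where X: "X \<in> S" and Y: "Y \<in> T'"
    and XY: "\<forall>i<length ks. ks ! i \<and> card (?As ! i \<union> ?Bs ! i) < 2 * s \<longrightarrow> X ! i = Y ! i"
    using thick_matching[OF G(5) H(2) s(1), of ?As ?Bs] G H finite_rows_over
    by (auto simp: fibre_def)
  obtain i where i: "i < m" "(X ! i \<in> G) \<noteq> (Y ! i \<in> H)" "X ! i \<noteq> Y ! i"
    using same_formula[OF G(7) H(3) eq(4) X Y] by blast
  have "length X = m" "rowwise (\<lambda>x. x \<in> G) X = a" "length Y = m" "rowwise (\<lambda>x. x \<in> H) Y = b"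
    using X Y G H by (auto simp: fibre_iff bool_matrices_def)
  then have ab: "(X ! i \<in> G) = a ! i" "(Y ! i \<in> H) = b ! i" using i(1) by (auto simp: rowwise_def)
  \<comment> \<open>Since \<open>a ! i\<close> and \<open>b ! i\<close> differ, a point of the
    second row set outside the first class of \<open>G\<close> is one where \<open>G\<close> and
    \<open>H\<close> agree, and those are few.\<close>
  have "?As ! i \<union> ?Bs ! i \<subseteq> {x \<in> cube n. (x \<in> G) = a ! i} \<union> {v \<in> cube n. v \<in> G \<longleftrightarrow> v \<in> H}"
    using i ab G by (auto simp: rows_over_def)
  then have "card (?As ! i \<union> ?Bs ! i) \<le> card ({x \<in> cube n. (x \<in> G) = a ! i} \<union> {v \<in> cube n. v \<in> G \<longleftrightarrow> v \<in> H})"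
    by (rule card_mono[rotated]) (simp add: finite_cube)
  also have "\<dots> \<le> card {x \<in> cube n. (x \<in> G) = a ! i} + card {v \<in> cube n. v \<in> G \<longleftrightarrow> v \<in> H}"
    by (rule card_Un_le)
  also have "card {x \<in> cube n. (x \<in> G) = a ! i} = q"
  proof (cases "a ! i")
    case True
    then have "{x \<in> cube n. (x \<in> G) = a ! i} = G" using Bal(1) by (auto simp: Bal_def)
    then show ?thesis using Bal(1) by (simp add: Bal_def)
  next
    case False
    then have "{x \<in> cube n. (x \<in> G) = a ! i} = cube n - G" by auto
    moreover have "card (cube n - G) = N - q"
      using Bal(1) finite_cube[of n] card_Diff_subset[of G "cube n"] finite_subset[of G "cube n"]
      by (simp add: Bal_def N_def)
    ultimately show ?thesis by (simp add: Nq)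
  qed
  finally have "real (card (?As ! i \<union> ?Bs ! i)) \<le> real q + real N / 100" using GH(3) by linarith
  also have "\<dots> < 2 * real s" using s by (simp add: q_def N_def)
  finally have "card (?As ! i \<union> ?Bs ! i) < 2 * s" by linarith
  moreover have "ks ! i" using G(6) i ab by blast
  ultimately show False using XY i G by auto
qed

section \<open>Choice of parameters and assembly\<close>

lemma rect_size_le_full: "disjoint_rect m A B \<Longrightarrow> rect_size m A B \<le> 3 * 2 ^ m"
proof -
  assume rect: "disjoint_rect m A B"
  have "rect_size m A B + 2 \<le> 3 * 2 ^ card {..<m}"
  proof (rule rect_size_differ_within[OF _ _ rect])
    show "\<forall>a\<in>A. \<forall>b\<in>B. \<exists>i\<in>{..<m}. a ! i \<noteq> b ! i"
    proof (intro ballI)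
      fix a b assume "a \<in> A" "b \<in> B"
      then have "length a = m" "length b = m" "a \<noteq> b" using rect by (auto simp: disjoint_rect_def cube_def)
      then show "\<exists>i\<in>{..<m}. a ! i \<noteq> b ! i" using list_eq_iff_nth_eq[of a b] by auto
    qed
  qed auto
  then show ?thesis by simp
qed

lemma leaves_pos: "leaves P \<ge> 1"
  by (induction P) auto

lemma rect_size_pos: "disjoint_rect m A B \<Longrightarrow> rect_size m A B \<ge> 1"
  using rect_size_attained leaves_pos by metis

lemma exists_nonconstant:
  assumes "n \<ge> 1"
  shows "\<exists>g. nonconstant n g"
proof -
  have "replicate n True \<in> cube n" "replicate n False \<in> cube n" by (auto simp: cube_def)
  moreover have "hd (replicate n True) \<noteq> hd (replicate n False)" using assms by (cases n) auto
  ultimately show ?thesis unfolding nonconstant_def by blast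
qed

text \<open>One factor \<open>Y\<close> of \<open>Y ^ 20\<close> pays for the logarithm of the
  number of node labels. The remaining \<open>Y ^ 19 \<ge> 2 ^ 19\<close> beats the constants:
  \<open>(4 + 12) / 2 ^ 19 = 1 / 32768 < 1 / 30000\<close>.\<close>

lemma counting_bound:
  fixes m n k :: nat and Y :: real
  assumes Y: "2 \<le> Y" "real m * real n \<le> Y" and mn: "1 \<le> m" "1 \<le> n"
    and n: "Y ^ 20 < 2 ^ n" and k: "2 ^ k * Y ^ 20 \<le> 2 ^ n"
  shows "real (2 ^ n) * (2 ^ (3 * m) * real (4 * m * n + 4) ^ (2 ^ (k + 1))) < exp (real (2 ^ n) / 30000)"
proof -
  define N :: real where "N = 2 ^ n"
  have exp1: "(2::real) \<le> exp 1" using exp_ge_add_one_self[of "1::real"] by simp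
  have two: "(2::real) ^ j \<le> exp (real j)" for j
  proof -
    have "(2::real) ^ j \<le> exp 1 ^ j" using exp1 by (intro power_mono) auto
    then show ?thesis by (simp add: exp_of_nat_mult[symmetric])
  qed
  have mY: "real m \<le> Y" "real n \<le> Y"
  proof -
    have "real m * 1 \<le> real m * real n" "1 * real n \<le> real m * real n"
      using mn by (intro mult_left_mono mult_right_mono; simp)+
    then show "real m \<le> Y" "real n \<le> Y" using Y by linarith+
  qed
  have "real (4 * m * n + 4) \<le> 6 * Y" using Y by simp
  also have "\<dots> \<le> exp (6 * Y)" using exp_ge_add_one_self[of "6 * Y"] by linarith
  finally have "real (4 * m * n + 4) ^ (2 ^ (k + 1)) \<le> exp (6 * Y) ^ (2 ^ (k + 1))"
    by (intro power_mono) auto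
  also have "\<dots> = exp (real (2 ^ (k + 1)) * (6 * Y))" by (rule exp_of_nat_mult[symmetric])
  finally have 1: "real (4 * m * n + 4) ^ (2 ^ (k + 1)) \<le> exp (12 * Y * 2 ^ k)"
    by (simp add: mult_ac)
  have "real (2 ^ n) * (2 ^ (3 * m) * real (4 * m * n + 4) ^ (2 ^ (k + 1))) \<le>
      exp (real n) * (exp (real (3 * m)) * exp (12 * Y * 2 ^ k))"
    using two[of n] two[of "3 * m"] 1 by (intro mult_mono) auto
  also have "\<dots> = exp (real n + 3 * real m + 12 * Y * 2 ^ k)" by (simp add: exp_add)
  also have "\<dots> < exp (real (2 ^ n) / 30000)"
  proof -
    have Y19: "2 ^ 19 \<le> Y ^ 19" using Y by (intro power_mono) auto
    have "2 ^ 19 * (2 ^ k * Y) \<le> Y ^ 19 * (2 ^ k * Y)"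
      using Y19 Y by (intro mult_right_mono) auto
    also have "\<dots> = 2 ^ k * Y ^ 20" by (simp add: power_numeral_reduce)
    also have "\<dots> \<le> N" using k by (simp add: N_def)
    finally have a: "2 ^ 19 * (2 ^ k * Y) \<le> N" .
    have "2 ^ 19 * Y \<le> Y ^ 19 * Y" using Y19 Y by (intro mult_right_mono) auto
    also have "\<dots> = Y ^ 20" by (simp add: power_numeral_reduce)
    also have "\<dots> < N" using n by (simp add: N_def)
    finally have b: "2 ^ 19 * Y < N" .
    have "real n + 3 * real m + 12 * Y * 2 ^ k \<le> 4 * Y + 12 * (2 ^ k * Y)"
      using mY by (simp add: mult_ac)
    also have "\<dots> < N / 30000"
    proof -
      have "0 < N" by (simp add: N_def)
      with a b show ?thesis by simp
    qed
    finally show ?thesis by (simp add: N_def)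
  qed
  finally show ?thesis .
qed

text \<open>The coefficient \<open>29 = 20 + 8 + 1\<close> collects the gap \<open>20 * l\<close>
  between \<open>n\<close> and the remaining depth \<open>k\<close>, the slack \<open>8 * l\<close>
  in \<open>x\<close>, and one \<open>l\<close> for rounding \<open>x\<close> down to
  \<open>t\<close>.\<close>

lemma strong_comp_lower_bound:
  fixes f :: "bool list \<Rightarrow> bool" and l lg :: real
  assumes f: "nonconstant m f" and n: "n \<ge> 1" and l: "l \<ge> 1" "log 2 (real m * real n) \<le> l" "20 * l < n"
    and lg: "lg = log 2 (real (protocol_size (KW m f)))"
  shows "\<exists>g. nonconstant n g \<and>
    lg - (1 - 1 / 24) * real m + real n - 29 * l \<le> real (CC (strong_comp_KW m n f g))"
proof (rule ccontr)
  assume neg: "\<not> ?thesis"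
  let ?A = "{x \<in> cube m. f x}" and ?B = "{y \<in> cube m. \<not> f y}"
  note rect = disjoint_rect_preimages[of m f]
  have m: "m \<ge> 1"
  proof (rule ccontr)
    assume "\<not> m \<ge> 1"
    then have "m = 0" by simp
    then show False using f by (auto simp: nonconstant_def cube_def)
  qed
  define Y where "Y = 2 powr l"
  have Y: "2 \<le> Y" "real m * real n \<le> Y"
  proof -
    have "2 powr 1 \<le> 2 powr l" using l by (intro powr_mono) auto
    then show "2 \<le> Y" by (simp add: Y_def)
    have "real m * real n = 2 powr (log 2 (real m * real n))" using m n by simp
    also have "\<dots> \<le> Y" unfolding Y_def using l by (intro powr_mono) auto
    finally show "real m * real n \<le> Y" .
  qed
  have mY: "real m \<le> Y"
  proof -
    have "real m * 1 \<le> real m * real n" using n by (intro mult_left_mono) auto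
    then show ?thesis using Y by linarith
  qed
  have Ypow: "Y ^ j = 2 powr (real j * l)" for j
    using l by (simp add: Y_def powr_realpow[symmetric] powr_powr mult.commute)
  define q where "q = (2::nat) ^ (n - 1)"
  \<comment> \<open>Rounding up strictly gives
    \<open>2 * s > 102 / 100 * q = q + 2 ^ n / 100\<close>, while \<open>s - 1\<close> still obeys
    the bound demanded by \<open>thick_card\<close>.\<close>
  define s where "s = nat \<lfloor>51 / 100 * real q\<rfloor> + 1"
  have s: "s > 0" "real s - 1 \<le> 51 / 100 * real q" "51 / 100 * real q < real s"
    unfolding s_def by linarith+
  have q: "q \<ge> 4"
  proof -
    have "n \<ge> 3" using l by linarith
    then have "(2::nat) ^ 2 \<le> 2 ^ (n - 1)" by (intro power_increasing) auto
    then show ?thesis by (simp add: q_def)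
  qed
  have sq: "s \<le> q"
  proof -
    have "real s \<le> real q" using s(2) q by linarith
    then show ?thesis by simp
  qed
  \<comment> \<open>The slack \<open>8 * l\<close> absorbs the factor
    \<open>48 * m^2 < Y ^ 8\<close> of the announcements. If \<open>x\<close> is below 1, then
    \<open>t = 0\<close> and nothing is walked.\<close>
  define x where "x = lg - 23 / 24 * real m - 8 * l"
  define t where "t = nat \<lfloor>x\<rfloor>"
  define k where "k = nat \<lfloor>real n - 20 * l\<rfloor>"
  have k: "2 ^ k * Y ^ 20 \<le> 2 ^ n"
  proof -
    have "real k \<le> real n - 20 * l" unfolding k_def using l by linarith
    then have "2 powr (real k + 20 * l) \<le> 2 powr real n" by (intro powr_mono) auto
    then show ?thesis using Ypow[of 20] by (simp add: powr_add powr_realpow)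
  qed
  have n20: "Y ^ 20 < 2 ^ n"
  proof -
    have "2 powr (20 * l) < 2 powr real n" using l by (intro powr_less_mono) auto
    then show ?thesis using Ypow[of 20] by (simp add: powr_realpow)
  qed
  have size_pos: "rect_size m ?A ?B \<ge> 1" by (rule rect_size_pos[OF rect])
  then have lg': "2 powr lg = real (rect_size m ?A ?B)" by (simp add: lg KW_eq_KW_on)
  have "lg \<le> m + 2"
  proof -
    have "rect_size m ?A ?B \<le> 4 * 2 ^ m" using rect_size_le_full[OF rect] by simp
    then have "real (rect_size m ?A ?B) \<le> real (4 * 2 ^ m)" by (simp only: of_nat_le_iff)
    also have "\<dots> = 2 powr (real m + 2)" by (simp add: powr_add powr_realpow)
    finally have "2 powr lg \<le> 2 powr (real m + 2)" by (simp add: lg')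
    then show ?thesis by simp
  qed
  show False
  proof (rule no_cheap_family[where m = m and n = n and s = s and k = k])
    show "real (2 ^ (n - 1)) + real (2 ^ n) / 100 < 2 * real s"
    proof -
      have "real (2 ^ n) = 2 * real q" using n by (cases n) (auto simp: q_def)
      then show ?thesis using s(3) unfolding q_def by linarith
    qed
    show "real (2 ^ n) * (2 ^ (3 * m) * real (4 * m * n + 4) ^ (2 ^ (k + 1))) < exp (real (2 ^ n) / 30000)"
      by (rule counting_bound[OF Y m n n20 k])
  next
    fix G assume G: "G \<subseteq> cube n" "card G = 2 ^ (n - 1)"
    let ?g = "\<lambda>x. x \<in> G"
    have cardG: "card {x \<in> cube n. ?g x = c} = q" for c
    proof (cases c)
      case True
      then have "{x \<in> cube n. ?g x = c} = G" using G by auto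
      then show ?thesis using G by (simp add: q_def)
    next
      case False
      then have "{x \<in> cube n. ?g x = c} = cube n - G" by auto
      moreover have "card (cube n - G) = 2 ^ n - 2 ^ (n - 1)"
        using G finite_cube[of n] card_Diff_subset[of G "cube n"] finite_subset[of G "cube n"] by simp
      ultimately show ?thesis using n by (cases n) (auto simp: q_def)
    qed
    have rows: "\<forall>R\<in>set (rows_over n ?g a). finite R \<and> card R = q" for a
      using finite_rows_over[of n ?g a] cardG by (auto simp: rows_over_def)
    have "nonconstant n ?g"
    proof -
      have "{x \<in> cube n. ?g x = True} \<noteq> {}" "{x \<in> cube n. ?g x = False} \<noteq> {}"
        using cardG[of True] cardG[of False] q by (metis card.empty not_numeral_le_zero)+
      then show ?thesis unfolding nonconstant_def by blast
    qed
    then have cheap: "real (CC (strong_comp_KW m n f ?g)) < x + real n - 21 * l"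
      using neg by (auto simp: x_def not_le)
    obtain P0 where "solves P0 (strong_comp_KW m n f ?g)" using strong_comp_solvable by blast
    from CC_attained[OF this] obtain P
      where P: "solves P (strong_comp_KW m n f ?g)" "real (depth P) < x + real n - 21 * l"
      using cheap by auto
    have correct: "strongly_differ m n ?g X Y (run P X Y)"
      if "a \<in> ?A" "b \<in> ?B" "X \<in> fibre n ?g a" "Y \<in> fibre n ?g b" for a b X Y
      using strong_comp_correct[OF P(1), of a b X Y] that by blast
    have depth: "depth P - t \<le> k"
    proof -
      have "x < real t + 1" unfolding t_def by linarith
      then have "real (depth P) < real t + real n - 20 * l" using P(2) l by linarith
      then show ?thesis unfolding k_def by linarith
    qed
    show "\<exists>P a b ks S T. depth P \<le> k \<and> a \<in> cube m \<and> b \<in> cube m \<and> ks \<in> cube m \<and>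
        S \<subseteq> fibre n ?g a \<and> T \<subseteq> fibre n ?g b \<and> thick s ks S \<and> thick s ks T \<and>
        (\<forall>i<m. \<not> ks ! i \<longrightarrow> a ! i = b ! i) \<and>
        (\<forall>X\<in>S. \<forall>Y\<in>T. strongly_differ m n ?g X Y (run P X Y))"
    proof (cases "t = 0")
      case True
      \<comment> \<open>Without a walk the complete fibres are thick in all rows, so no agreement
        between \<open>a\<close> and \<open>b\<close> is required.\<close>
      obtain a b where ab: "a \<in> ?A" "b \<in> ?B" using f unfolding nonconstant_def by blast
      let ?ks = "replicate m True"
      have "thick s ?ks (fibre n ?g a)" if "length a = m" for a
        unfolding fibre_def using rows[of a] sq s(1) that by (intro thick_full) auto
      then have "thick s ?ks (fibre n ?g a)" "thick s ?ks (fibre n ?g b)"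
        using ab by (auto simp: cube_def)
      moreover have "?ks \<in> cube m" by (simp add: cube_def)
      moreover have "\<forall>i<m. \<not> ?ks ! i \<longrightarrow> a ! i = b ! i" by simp
      moreover have "depth P \<le> k" using depth True by simp
      ultimately show ?thesis using ab correct
        by (intro exI[of _ P] exI[of _ a] exI[of _ b] exI[of _ ?ks] exI[of _ "fibre n ?g a"]
            exI[of _ "fibre n ?g b"]) auto
    next
      case False
      then have t: "real t \<le> x" "x > 0" unfolding t_def by linarith+
      \<comment> \<open>From \<open>0 < x \<le> m / 24 + 2 - 8 * l\<close> and
        \<open>l \<ge> 1\<close> follows \<open>m > 144\<close>, and \<open>t \<le> x\<close> is
        below \<open>m / 24\<close>.\<close>
      have tm: "24 * real t \<le> real m" and m100: "100 \<le> m"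
        using t \<open>lg \<le> m + 2\<close> l(1) by (auto simp: x_def)
      have "\<exists>Q A' B' S T tA tB. walked m t P ?A ?B (fibre n ?g) (fibre n ?g) Q A' B' S T tA tB"
        by (rule walk[OF rect]) (simp_all add: finite_fibre)
      then obtain Q A' B' S T tA tB
        where w: "walked m t P ?A ?B (fibre n ?g) (fibre n ?g) Q A' B' S T tA tB" by blast
      have w1: "depth Q \<le> k" "A' \<subseteq> ?A" "B' \<subseteq> ?B" "tA + tB \<le> t"
        "rect_size m ?A ?B \<le> 2 ^ t * rect_size m A' B'"
        using w depth unfolding walked_def by (linarith | blast)+
      have wS: "S a \<subseteq> fibre n ?g a" "card (fibre n ?g a) \<le> 2 ^ tA * card (S a)" if "a \<in> A'" for a
        using w that unfolding walked_def by blast+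
      have wT: "T b \<subseteq> fibre n ?g b" "card (fibre n ?g b) \<le> 2 ^ tB * card (T b)" if "b \<in> B'" for b
        using w that unfolding walked_def by blast+
      have wrun: "run Q X Y = run P X Y" if "a \<in> A'" "b \<in> B'" "X \<in> S a" "Y \<in> T b" for a b X Y
        using w that unfolding walked_def by blast
      have rect': "disjoint_rect m A' B'" by (rule disjoint_rect_subset[OF rect w1(2,3)])
      have cardF: "card (fibre n ?g a) = q ^ m" if "length a = m" for a
        unfolding fibre_def using card_lists_over[OF rows[of a]] that by simp
      have len: "length a = m" if "a \<in> A' \<or> a \<in> B'" for a
        using that w1(2,3) by (auto simp: cube_def)
      have size: "48 * real m ^ 2 * 2 powr (11 / 12 * m) * 2 ^ t < rect_size m A' B'"
      proof -
        have "48 * real m ^ 2 < Y ^ 8"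
        proof -
          have "real m ^ 2 \<le> Y ^ 2" using mY by (intro power_mono) auto
          then have "48 * real m ^ 2 \<le> 48 * Y ^ 2" by simp
          also have "\<dots> < 2 ^ 6 * Y ^ 2" using Y by simp
          also have "\<dots> \<le> Y ^ 6 * Y ^ 2" using Y by (intro mult_right_mono power_mono) auto
          finally show ?thesis by (simp add: power_add[symmetric])
        qed
        then have "48 * real m ^ 2 * 2 powr (11 / 12 * m + 2 * t) < 2 powr (8 * l) * 2 powr (11 / 12 * m + 2 * t)"
          using Ypow[of 8] by (intro mult_strict_right_mono) auto
        also have "\<dots> = 2 powr (8 * l + (11 / 12 * m + 2 * t))" by (simp add: powr_add)
        \<comment> \<open>One \<open>t\<close> is bounded by \<open>x\<close>, the other by
          \<open>m / 24\<close>; then \<open>- 23 / 24 + 11 / 12 + 1 / 24 = 0\<close> cancels all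
          multiples of \<open>m\<close>.\<close>
        also have "\<dots> \<le> 2 powr lg" using t tm by (intro powr_mono) (auto simp: x_def)
        also have "\<dots> \<le> real (2 ^ t * rect_size m A' B')"
          unfolding lg' using w1(5) by (simp only: of_nat_le_iff)
        finally have "48 * real m ^ 2 * 2 powr (11 / 12 * m + 2 * t) < 2 ^ t * real (rect_size m A' B')"
          by simp
        moreover have "2 powr (11 / 12 * m + 2 * t) = 2 ^ t * (2 powr (11 / 12 * m) * 2 ^ t)"
        proof -
          have "(11 / 12 * m + 2 * t :: real) = t + (11 / 12 * m + t)" by simp
          then show ?thesis by (simp only: powr_add powr_realpow)
        qed
        ultimately show ?thesis by (simp add: mult_ac)
      qed
      have "\<exists>ks a b. length ks = m \<and> a \<in> A' \<and> b \<in> B' \<and> thick s ks (S a) \<and> thick s ks (T b) \<and>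
          (\<forall>i<m. \<not> ks ! i \<longrightarrow> a ! i = b ! i)"
      proof (rule find_flags[OF rect' m100 w1(4), where q = q and As = "rows_over n ?g" and Bs = "rows_over n ?g"])
        show "24 * t \<le> m" using tm by linarith
        show "\<forall>a\<in>A'. S a \<subseteq> {xs. list_all2 (\<in>) xs (rows_over n ?g a)} \<and> length (rows_over n ?g a) = m \<and>
            (\<forall>R\<in>set (rows_over n ?g a). finite R \<and> card R = q) \<and> q ^ m \<le> 2 ^ tA * card (S a)"
          using wS len rows cardF unfolding fibre_def[symmetric] by (metis length_rows_over)
        show "\<forall>a\<in>B'. T a \<subseteq> {xs. list_all2 (\<in>) xs (rows_over n ?g a)} \<and> length (rows_over n ?g a) = m \<and>
            (\<forall>R\<in>set (rows_over n ?g a). finite R \<and> card R = q) \<and> q ^ m \<le> 2 ^ tB * card (T a)"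
          using wT len rows cardF unfolding fibre_def[symmetric] by (metis length_rows_over)
      qed (use s q size in auto)
      then obtain ks a b where ks: "length ks = m" "a \<in> A'" "b \<in> B'" "thick s ks (S a)" "thick s ks (T b)"
        "\<forall>i<m. \<not> ks ! i \<longrightarrow> a ! i = b ! i" by blast
      have "\<forall>X\<in>S a. \<forall>Y\<in>T b. strongly_differ m n ?g X Y (run Q X Y)"
      proof (intro ballI)
        fix X Y assume XY: "X \<in> S a" "Y \<in> T b"
        then have "strongly_differ m n ?g X Y (run P X Y)"
          by (rule correct[OF subsetD[OF w1(2) ks(2)] subsetD[OF w1(3) ks(3)]
            subsetD[OF wS(1)[OF ks(2)]] subsetD[OF wT(1)[OF ks(3)]]])
        then show "strongly_differ m n ?g X Y (run Q X Y)" using wrun[OF ks(2,3) XY] by simp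
      qed
      moreover have "a \<in> cube m" "b \<in> cube m" "ks \<in> cube m" using ks len by (auto simp: cube_def)
      ultimately show ?thesis using ks w1(1) wS(1) wT(1)
        by (intro exI[of _ Q] exI[of _ a] exI[of _ b] exI[of _ ks] exI[of _ "S a"] exI[of _ "T b"]) auto
    qed
  qed (use n s in auto)
qed

theorem theorem3p1:
  "\<exists>\<gamma>::real. \<gamma> > 0.04 \<and> (\<exists>C::real. C > 0 \<and>
    (\<forall>(m::nat) (f :: bool list \<Rightarrow> bool). nonconstant m f \<longrightarrow>
      (\<forall>n::nat. n \<ge> 1 \<longrightarrow>
        (\<exists>g :: bool list \<Rightarrow> bool. nonconstant n g \<and>
          real (CC (strong_comp_KW m n f g))
            \<ge> log 2 (real (protocol_size (KW m f))) - (1 - \<gamma>) * real m + real n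
              - C * max 1 (log 2 (real m * real n))))))"
proof (rule exI[of _ "1 / 24"], intro conjI exI[of _ 29] allI impI)
  fix m n :: nat and f :: "bool list \<Rightarrow> bool"
  assume f: "nonconstant m f" and n: "n \<ge> 1"
  define l where "l = max 1 (log 2 (real m * real n))"
  define lg where "lg = log 2 (real (protocol_size (KW m f)))"
  have l: "l \<ge> 1" "log 2 (real m * real n) \<le> l" by (simp_all add: l_def)
  have "\<exists>g. nonconstant n g \<and>
    lg - (1 - 1 / 24) * real m + real n - 29 * l \<le> real (CC (strong_comp_KW m n f g))"
  proof (cases "20 * l < n")
    case True
    then show ?thesis by (rule strong_comp_lower_bound[OF f n l _ lg_def])
  next
    \<comment> \<open>Now \<open>n - 29 * l\<close> is negative, so it is enough that the complexity
      is at least \<open>lg\<close>.\<close>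
    case False
    obtain g where g: "nonconstant n g" using exists_nonconstant[OF n] by blast
    obtain P0 where "solves P0 (strong_comp_KW m n f g)" using strong_comp_solvable by blast
    from CC_attained[OF this] obtain P where P: "solves P (strong_comp_KW m n f g)"
      "depth P = CC (strong_comp_KW m n f g)" by blast
    have pos: "protocol_size (KW m f) \<ge> 1"
      unfolding KW_eq_KW_on by (rule rect_size_pos[OF disjoint_rect_preimages])
    have "real (protocol_size (KW m f)) \<le> real (2 ^ depth P)"
      using protocol_size_KW_le_depth[OF g P(1)] by (simp only: of_nat_le_iff)
    then have "lg \<le> log 2 (2 ^ depth P)" unfolding lg_def using pos by (intro log_mono) simp_all
    then have "lg \<le> real (CC (strong_comp_KW m n f g))" using P(2) by simp
    with False l(1) have "lg - (1 - 1 / 24) * real m + real n - 29 * l \<le> real (CC (strong_comp_KW m n f g))"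
      by simp
    with g show ?thesis by blast
  qed
  then show "\<exists>g. nonconstant n g \<and> real (CC (strong_comp_KW m n f g)) \<ge>
      log 2 (real (protocol_size (KW m f))) - (1 - 1 / 24) * real m + real n
        - 29 * max 1 (log 2 (real m * real n))"
    by (simp only: l_def lg_def)
qed auto

end
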